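(* Let $g\in\mathrm{GL}^+(2,\mathbb{C})$ and consider the condition $$(\ast)\qquad g=e^{\xi/2}g_1,\quad\text{where } g_1\in\mathrm{SL}(2,\mathbb{C}),\quad \xi\ge\eta:=\rho(e,g_1)>0.$$ Suppose $(\ast)$ holds, and let $\gamma=\gamma(t)$, $0\le t\le\eta$, be an arbitrary shortest arc in $(\mathrm{SL}(2,\mathbb{C}),\rho)$, parametrized by arclength, such that $\gamma(0)=e$, $\gamma(\eta)=g_1$. (1) If $\xi>\eta$, then the curve $$g(t)=e^{\cosh(c)t/2}\,\gamma(\sinh(c)t),\quad 0\le t\le k,\quad\text{where } k>0,\ c>0,\ \xi=k\cosh(c),\ \eta=k\sinh(c),$$ is a timelike longest arc in $(\mathrm{GL}^+(2,\mathbb{C}),d)$ which joins $e$ and $g$. (2) If $\xi=\eta$, then the curve $g(t)=e^{t/2}\gamma(t)$, $0\le t\le\xi$, is an isotropic longest arc in $(\mathrm{GL}^+(2,\mathbb{C}),d)$ joining $e$ and $g$. (3) If $g\in\mathrm{GL}^+(2,\mathbb{C})$, $g\notin\mathbb{R}_+I$ and condition $(\ast)$ is not satisfied, then there is no future directed nonspacelike horizontal curve joining $e$ and $g$ (i.e. going from $e$ to $g$).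
   Context: $\mathrm{GL}^+(2,\mathbb{C})$ is the Lie group of complex $2\times2$ matrices with positive real determinant, with unit $e=I$; its Lie algebra $\mathfrak{gl}^+(2,\mathbb{C})$ (complex $2\times2$ matrices with real trace) has the real basis $e_0=\frac12 I$, $e_1=\frac12\begin{pmatrix}0&1\\1&0\end{pmatrix}$, $e_2=\frac12\begin{pmatrix}0&\mathbf{i}\\-\mathbf{i}&0\end{pmatrix}$, $e_3=\frac12\begin{pmatrix}1&0\\0&-1\end{pmatrix}$, $e_4=\mathbf{i}e_1$, $e_5=\mathbf{i}e_2$, $e_6=\mathbf{i}e_3$. $H=\mathrm{span}_{\mathbb{R}}(e_0,e_1,e_2,e_3)$ is the space of Hermitian matrices, with pseudoscalar product $\langle\cdot,\cdot\rangle$ whose quadratic form is $\langle h,h\rangle=h_0^2-h_1^2-h_2^2-h_3^2=4\det h$ for $h=\sum_{i=0}^3h_ie_i$. $l_g:h\mapsto gh$ is the left shift. A horizontal curve in $\mathrm{GL}^+(2,\mathbb{C})$ is a Lipschitzian curve with $g'(t)=dl_{g(t)}(u(t))$, $u(t)\in H$ for almost all $t$. It is timelike (resp. nonspacelike; isotropic) if for almost all $t$ $\langle u(t),u(t)\rangle>0$ (resp. $\ge0$; $=0$ with $u(t)\ne0$), and future directed if $\langle u(t),e_0\rangle>0$ for almost all $t$. The length of a nonspacelike curve is $\int\sqrt{\langle u(t),u(t)\rangle}\,dt$. The sub-Lorentzian (anti)metric $d(x,y)$ is the supremum of lengths of future directed nonspacelike horizontal curves from $x$ to $y$ ($-\infty$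 if there are none); a longest arc is a future directed nonspacelike horizontal curve realizing this supremum between its endpoints. On $\mathrm{SL}(2,\mathbb{C})$: $H_0=\mathrm{span}_{\mathbb{R}}(e_1,e_2,e_3)$ with scalar product $(\cdot,\cdot)$ for which $e_1,e_2,e_3$ are orthonormal; $\rho(x,y)$ is the infimum of the lengths $\int_0^a\sqrt{(u,u)}\,dt$ of piecewise continuously differentiable paths from $x$ to $y$ in $\mathrm{SL}(2,\mathbb{C})$ with $\gamma'(t)=dl_{\gamma(t)}(u(t))$, $u(t)\in H_0$. A shortest arc is a horizontal (i.e. $u(t)\in H_0$) curve whose length equals the $\rho$-distance between its endpoints. $\mathbb{R}_+$ is the set of positive reals. *)

theory Defs
  imports "HOL-Analysis.Analysis"
begin

type_synonym cmat = "complex ^ 2 ^ 2"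

definition GLp :: "cmat set"
  where "GLp = {A. det A \<in> \<real> \<and> 0 < Re (det A)}"

definition SL2 :: "cmat set"
  where "SL2 = {A. det A = 1}"

definition e0 :: cmat where "e0 = (1/2) *\<^sub>R mat 1"
definition e1 :: cmat where "e1 = (1/2) *\<^sub>R vector [vector [0, 1], vector [1, 0]]"
definition e2 :: cmat where "e2 = (1/2) *\<^sub>R vector [vector [0, \<i>], vector [- \<i>, 0]]"
definition e3 :: cmat where "e3 = (1/2) *\<^sub>R vector [vector [1, 0], vector [0, -1]]"

definition H :: "cmat set"
  where "H = span {e0, e1, e2, e3}"

definition H0 :: "cmat set"
  where "H0 = span {e1, e2, e3}"

text \<open>The coordinates of a matrix of \<open>H\<close> in the basis \<open>e0, e1, e2, e3\<close>; see \<open>coords_combination\<close>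
  and \<open>H_expansion\<close> below. Outside \<open>H\<close> these functionals have no meaning.\<close>

definition x0 :: "cmat \<Rightarrow> real" where "x0 h = Re (h $ 1 $ 1 + h $ 2 $ 2)"
definition x1 :: "cmat \<Rightarrow> real" where "x1 h = Re (h $ 1 $ 2 + h $ 2 $ 1)"
definition x2 :: "cmat \<Rightarrow> real" where "x2 h = Im (h $ 1 $ 2 - h $ 2 $ 1)"
definition x3 :: "cmat \<Rightarrow> real" where "x3 h = Re (h $ 1 $ 1 - h $ 2 $ 2)"

definition pseudo_prod :: "cmat \<Rightarrow> cmat \<Rightarrow> real"
  where "pseudo_prod h k = x0 h * x0 k - x1 h * x1 k - x2 h * x2 k - x3 h * x3 k"

definition scal_prod :: "cmat \<Rightarrow> cmat \<Rightarrow> real"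
  where "scal_prod h k = x1 h * x1 k + x2 h * x2 k + x3 h * x3 k"

lemma coords_combination:
  fixes a b c d :: real
  defines "h \<equiv> a *\<^sub>R e0 + b *\<^sub>R e1 + c *\<^sub>R e2 + d *\<^sub>R e3"
  shows "x0 h = a" "x1 h = b" "x2 h = c" "x3 h = d"
  by (simp_all add: h_def x0_def x1_def x2_def x3_def e0_def e1_def e2_def e3_def mat_def)

lemma H_expansion:
  assumes "h \<in> H"
  shows "h = x0 h *\<^sub>R e0 + x1 h *\<^sub>R e1 + x2 h *\<^sub>R e2 + x3 h *\<^sub>R e3"
proof -
  obtain a b c d where "h = a *\<^sub>R e0 + b *\<^sub>R e1 + c *\<^sub>R e2 + d *\<^sub>R e3"
    using assms unfolding H_def span_insert span_empty
    by (auto simp: algebra_simps eq_diff_eq diff_eq_eq)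
  then show ?thesis
    by (simp add: coords_combination)
qed

lemma pseudo_prod_det:
  assumes "h \<in> H"
  shows "complex_of_real (pseudo_prod h h) = 4 * det h"
proof -
  obtain a b c d where h: "h = a *\<^sub>R e0 + b *\<^sub>R e1 + c *\<^sub>R e2 + d *\<^sub>R e3"
    using H_expansion[OF assms] by blast
  show ?thesis
    unfolding pseudo_prod_def h coords_combination
    by (simp add: det_2 e0_def e1_def e2_def e3_def mat_def complex_eq_iff field_simps)
qed

text \<open>The control \<open>u\<close> is determined by the curve up to a null set: \<open>u t = (g t)\<^sup>-\<^sup>1 g' t\<close>.
  All notions below are insensitive to changing \<open>u\<close> on a null set.\<close>

definition left_control :: "cmat set \<Rightarrow> real \<Rightarrow> real \<Rightarrow> (real \<Rightarrow> cmat) \<Rightarrow> (real \<Rightarrow> cmat) \<Rightarrow> bool"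
  where "left_control V a b g u \<longleftrightarrow>
    (AE t in lebesgue. t \<in> {a..b} \<longrightarrow>
       u t \<in> V \<and> (g has_vector_derivative (g t ** u t)) (at t within {a..b}))"

definition horizontal_curve ::
    "cmat set \<Rightarrow> cmat set \<Rightarrow> real \<Rightarrow> real \<Rightarrow> (real \<Rightarrow> cmat) \<Rightarrow> (real \<Rightarrow> cmat) \<Rightarrow> bool"
  where "horizontal_curve G V a b g u \<longleftrightarrow>
    a < b \<and> (\<exists>L. L-lipschitz_on {a..b} g) \<and> g ` {a..b} \<subseteq> G \<and> left_control V a b g u"

definition timelike :: "real \<Rightarrow> real \<Rightarrow> (real \<Rightarrow> cmat) \<Rightarrow> bool"
  where "timelike a b u \<longleftrightarrow> (AE t in lebesgue. t \<in> {a..b} \<longrightarrow> pseudo_prod (u t) (u t) > 0)"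

definition nonspacelike :: "real \<Rightarrow> real \<Rightarrow> (real \<Rightarrow> cmat) \<Rightarrow> bool"
  where "nonspacelike a b u \<longleftrightarrow> (AE t in lebesgue. t \<in> {a..b} \<longrightarrow> pseudo_prod (u t) (u t) \<ge> 0)"

definition isotropic :: "real \<Rightarrow> real \<Rightarrow> (real \<Rightarrow> cmat) \<Rightarrow> bool"
  where "isotropic a b u \<longleftrightarrow>
    (AE t in lebesgue. t \<in> {a..b} \<longrightarrow> pseudo_prod (u t) (u t) = 0 \<and> u t \<noteq> 0)"

definition future_directed :: "real \<Rightarrow> real \<Rightarrow> (real \<Rightarrow> cmat) \<Rightarrow> bool"
  where "future_directed a b u \<longleftrightarrow> (AE t in lebesgue. t \<in> {a..b} \<longrightarrow> pseudo_prod (u t) e0 > 0)"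

definition fd_nonspacelike_curve :: "real \<Rightarrow> real \<Rightarrow> (real \<Rightarrow> cmat) \<Rightarrow> (real \<Rightarrow> cmat) \<Rightarrow> bool"
  where "fd_nonspacelike_curve a b g u \<longleftrightarrow>
    horizontal_curve GLp H a b g u \<and> nonspacelike a b u \<and> future_directed a b u"

definition lorentz_length :: "real \<Rightarrow> real \<Rightarrow> (real \<Rightarrow> cmat) \<Rightarrow> real"
  where "lorentz_length a b u = integral {a..b} (\<lambda>t. sqrt (pseudo_prod (u t) (u t)))"

text \<open>In \<open>ereal\<close> the supremum of the empty set is \<open>- \<infinity>\<close>.\<close>

definition lorentz_dist :: "cmat \<Rightarrow> cmat \<Rightarrow> ereal"
  where "lorentz_dist x y =
    Sup {ereal (lorentz_length a b u) | a b g u.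
           fd_nonspacelike_curve a b g u \<and> g a = x \<and> g b = y}"

definition longest_arc :: "real \<Rightarrow> real \<Rightarrow> (real \<Rightarrow> cmat) \<Rightarrow> (real \<Rightarrow> cmat) \<Rightarrow> bool"
  where "longest_arc a b g u \<longleftrightarrow>
    fd_nonspacelike_curve a b g u \<and> ereal (lorentz_length a b u) = lorentz_dist (g a) (g b)"

definition scal_length :: "real \<Rightarrow> real \<Rightarrow> (real \<Rightarrow> cmat) \<Rightarrow> real"
  where "scal_length a b u = integral {a..b} (\<lambda>t. sqrt (scal_prod (u t) (u t)))"

text \<open>Piecewise continuously differentiable in the classical sense: on each closed piece the
  derivative extends continuously to the endpoints. The library predicate
  \<open>piecewise_C1_differentiable_on\<close> would allow the derivative to blow up at the breakpoints, so
  that the length integral need not exist (and would then take the value 0).\<close>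

definition piecewise_C1 :: "real \<Rightarrow> real \<Rightarrow> (real \<Rightarrow> cmat) \<Rightarrow> bool"
  where "piecewise_C1 a b g \<longleftrightarrow>
    (\<exists>(n::nat) (p :: nat \<Rightarrow> real). p 0 = a \<and> p n = b \<and>
       (\<forall>i<n. p i < p (Suc i) \<and>
          (\<exists>D. continuous_on {p i..p (Suc i)} D \<and>
             (\<forall>t\<in>{p i..p (Suc i)}. (g has_vector_derivative D t) (at t within {p i..p (Suc i)})))))"

text \<open>Any two elements of \<open>SL2\<close> are joined by such a path, so the infimum is over a nonempty set of
  nonnegative reals.\<close>

definition rho :: "cmat \<Rightarrow> cmat \<Rightarrow> real"
  where "rho x y =
    Inf {scal_length 0 a u | a g u.
           0 < a \<and> piecewise_C1 0 a g \<and> g ` {0..a} \<subseteq> SL2 \<and> left_control H0 0 a g u \<and>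
           g 0 = x \<and> g a = y}"

definition shortest_arc :: "real \<Rightarrow> real \<Rightarrow> (real \<Rightarrow> cmat) \<Rightarrow> (real \<Rightarrow> cmat) \<Rightarrow> bool"
  where "shortest_arc a b g u \<longleftrightarrow>
    horizontal_curve SL2 H0 a b g u \<and> scal_length a b u = rho (g a) (g b)"

definition arclength_parametrized :: "real \<Rightarrow> real \<Rightarrow> (real \<Rightarrow> cmat) \<Rightarrow> bool"
  where "arclength_parametrized a b u \<longleftrightarrow> (\<forall>t\<in>{a..b}. scal_length a t u = t - a)"

definition rho_decomposition :: "cmat \<Rightarrow> real \<Rightarrow> cmat \<Rightarrow> real \<Rightarrow> bool"
  where "rho_decomposition g \<xi> g1 \<eta> \<longleftrightarrow>
    g = exp (\<xi> / 2) *\<^sub>R g1 \<and> g1 \<in> SL2 \<and> \<xi> \<ge> \<eta> \<and> \<eta> = rho (mat 1) g1 \<and> \<eta> > 0"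

end

theory Submission
  imports Defs
begin

text \<open>
  Every curve in \<open>GLp\<close> factors as \<open>f t = exp (s t / 2) \<gamma> t\<close> with \<open>\<gamma> t\<close> of determinant 1 and
  \<open>s t = ln (det (f t))\<close>. For a horizontal \<open>f\<close> with control \<open>u\<close>, the function \<open>s\<close> has derivative
  \<open>x0 u\<close>, the trace of the control, and \<open>\<gamma>\<close> is horizontal in \<open>SL2\<close> with control the traceless part
  \<open>v\<close> of \<open>u\<close>. If \<open>f\<close> starts at the unit, the endpoint \<open>f b = exp (\<xi> / 2) g1\<close> thus determines
  \<open>\<xi> = \<integral> x0 u\<close>, while the length of \<open>\<gamma>\<close> is \<open>\<integral> |v|\<close>, where \<open>|v| = sqrt (scal_prod v v)\<close>. The
  curve is nonspacelike and future directed iff \<open>x0 u\<close> is positive and \<open>|v| \<le> x0 u\<close> almost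
  everywhere, and its Lorentzian length is \<open>\<integral> sqrt ((x0 u)\<^sup>2 - |v|\<^sup>2)\<close>.

  Hence \<open>rho (mat 1) g1 \<le> \<integral> |v| \<le> \<xi>\<close> for every such curve. This is the nonexistence part, since
  \<open>rho (mat 1) g1 > 0\<close> unless \<open>g1\<close> is the unit (\<open>rho_pos\<close>).
  Moreover \<open>sqrt (x\<^sup>2 - r\<^sup>2) \<le> x cosh c - r sinh c\<close> whenever \<open>0 \<le> r \<le> x\<close>, so every curve from the
  unit to \<open>g\<close> has length at most \<open>\<xi> cosh c - \<eta> sinh c\<close>, for each \<open>c \<ge> 0\<close>. For \<open>\<xi> = k cosh c\<close> and
  \<open>\<eta> = k sinh c\<close> this bound is \<open>k\<close>, and for \<open>\<xi> = \<eta>\<close> it tends to 0 as \<open>c\<close> grows. The arcs built from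
  a shortest arc have constant \<open>x0 u\<close> and constant \<open>|v|\<close>, because an arclength parametrization has
  unit speed almost everywhere, and they attain these bounds. See \<open>curve_normalization\<close>,
  \<open>fd_nonspacelike_curve_bounds\<close> and \<open>scaled_arc\<close>.

  The point that needs work is \<open>rho (mat 1) g1 \<le> \<integral> |v|\<close>: the infimum in \<open>rho\<close> is over piecewise
  continuously differentiable paths, but \<open>\<gamma>\<close> is only Lipschitz. Averaging the control over \<open>n\<close> equal
  intervals gives a product \<open>Q\<close> of \<open>n\<close> exponentials of elements of \<open>H0\<close>. By convexity of the norm it
  is reached by a path not longer than \<open>\<gamma>\<close>. A step over an interval of length \<open>h\<close> has an error of
  order \<open>h\<^sup>2\<close>, so \<open>Q\<close> misses the endpoint of \<open>\<gamma>\<close> only by order \<open>1 / n\<close>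
  (\<open>steers_approximation\<close>). The gap is closed by a short horizontal path: although \<open>H0\<close> has
  codimension 3 in the Lie algebra, every matrix of determinant 1 near the unit is a product of
  twelve positive definite Hermitian matrices of determinant 1 close to it, and each of these is the
  exponential of a small element of \<open>H0\<close> (\<open>steers_near_mat_1\<close>).

  Two facts of real analysis underlie all this: the fundamental theorem of calculus for Lipschitz
  functions whose derivative is given almost everywhere (\<open>lipschitz_fundamental_theorem\<close>), and, for
  the unit speed, that an integrable function is determined almost everywhere by its indefinite
  integral (\<open>eq_1_AE_if_indefinite_integral_id\<close>).
\<close>

section \<open>Derivatives and integrals up to null sets\<close>

lemma AE_lebesgue_negligible:
  "(AE t in lebesgue. P t) \<longleftrightarrow> negligible {t. \<not> P t}"
proof
  assume "AE t in lebesgue. P t"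
  from AE_E3[OF this] obtain N where "\<And>t. t \<in> space lebesgue - N \<Longrightarrow> P t" "N \<in> null_sets lebesgue"
    by blast
  then have "N \<in> null_sets lebesgue" "{t. \<not> P t} \<subseteq> N" by auto
  then show "negligible {t. \<not> P t}"
    by (metis negligible_iff_null_sets negligible_subset)
next
  assume "negligible {t. \<not> P t}"
  then show "AE t in lebesgue. P t"
    by (intro AE_I'[of "{t. \<not> P t}"]) (auto simp: negligible_iff_null_sets)
qed

lemma difference_quotient_sequence:
  fixes f :: "real \<Rightarrow> 'a::real_normed_vector"
  assumes "(f has_vector_derivative D) (at t)"
  shows "(\<lambda>n. real (Suc n) *\<^sub>R (f (t + 1 / real (Suc n)) - f t)) \<longlonglongrightarrow> D"
proof -
  have "((\<lambda>s. (f s - f t - (s - t) *\<^sub>R D) /\<^sub>R norm (s - t)) \<longlongrightarrow> 0) (at t)"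
    using assms unfolding has_vector_derivative_def has_derivative_at_within by blast
  moreover have "filterlim (\<lambda>n. t + 1 / real (Suc n)) (at t) sequentially"
    by (intro filterlim_atI) (use tendsto_add[OF tendsto_const[of t] LIMSEQ_Suc[OF lim_1_over_n]] in simp_all)
  ultimately have "(\<lambda>n. (f (t + 1 / real (Suc n)) - f t - (t + 1 / real (Suc n) - t) *\<^sub>R D)
      /\<^sub>R norm (t + 1 / real (Suc n) - t)) \<longlonglongrightarrow> 0"
    by (rule filterlim_compose)
  moreover have "(f (t + 1 / real (Suc n)) - f t - (t + 1 / real (Suc n) - t) *\<^sub>R D)
      /\<^sub>R norm (t + 1 / real (Suc n) - t)
      = real (Suc n) *\<^sub>R (f (t + 1 / real (Suc n)) - f t) - D" for n
    by (simp add: scaleR_diff_right[of "1 + real n" _ "(1 / (1 + real n)) *\<^sub>R D"])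
  ultimately have "(\<lambda>n. real (Suc n) *\<^sub>R (f (t + 1 / real (Suc n)) - f t) - D) \<longlonglongrightarrow> 0"
    by (simp only:)
  then show ?thesis by (simp only: LIM_zero_iff)
qed

lemma integral_shift_Icc:
  fixes F :: "real \<Rightarrow> 'a::euclidean_space"
  assumes "continuous_on UNIV F"
  shows "integral {a..b} (\<lambda>t. F (t + c)) = integral {a + c..b + c} F"
proof (cases "a \<le> b")
  case True
  have "(F has_integral integral {a + c..b + c} F) (cbox (a + c) (b + c))"
    using assms by (auto intro!: integrable_integral integrable_continuous_real intro: continuous_on_subset)
  from has_integral_affinity'[OF this, of 1 c] show ?thesis
    by (simp add: integral_unique True)
qed simp

text \<open>The difference quotients of \<open>f\<close>, extended constantly beyond \<open>b\<close>, are bounded by \<open>L\<close> and converge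
  almost everywhere to \<open>D\<close>, and their integrals telescope to \<open>f b - f a\<close> in the limit; dominated
  convergence gives the claim. In particular \<open>D\<close> is measurable without being assumed so.\<close>

lemma lipschitz_fundamental_theorem:
  fixes f D :: "real \<Rightarrow> 'a::euclidean_space"
  assumes "a \<le> b" and lip: "L-lipschitz_on {a..b} f"
    and D: "AE t in lebesgue. t \<in> {a..b} \<longrightarrow> (f has_vector_derivative D t) (at t within {a..b})"
  shows "(D has_integral f b - f a) {a..b}"
    and "AE t in lebesgue. t \<in> {a..b} \<longrightarrow> norm (D t) \<le> L"
proof -
  \<comment> \<open>Clamping the argument extends \<open>f\<close> to the line with the same Lipschitz constant.\<close>
  define F where "F t = f (min b (max a t))" for t
  have L0: "L \<ge> 0" using lip by (rule lipschitz_on_nonneg)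
  have F_lip: "norm (F s - F t) \<le> L * \<bar>s - t\<bar>" for s t
  proof -
    have "norm (F s - F t) \<le> L * \<bar>min b (max a s) - min b (max a t)\<bar>"
      using lipschitz_on_normD[OF lip, of "min b (max a s)" "min b (max a t)"] \<open>a \<le> b\<close>
      unfolding F_def by auto
    also have "\<dots> \<le> L * \<bar>s - t\<bar>" by (intro mult_left_mono L0) auto
    finally show ?thesis .
  qed
  have F_cont: "continuous_on UNIV F"
    by (rule lipschitz_on_continuous_on[of L], rule lipschitz_onI)
       (use F_lip L0 in \<open>auto simp: dist_norm\<close>)
  define q where "q n t = real (Suc n) *\<^sub>R (F (t + 1 / real (Suc n)) - F t)" for n t
  define N where "N = {t. \<not> (t \<in> {a..b} \<longrightarrow> (f has_vector_derivative D t) (at t within {a..b}))} \<union> {a, b}"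
  have N: "negligible N"
    using D unfolding N_def AE_lebesgue_negligible by simp
  have q_bound: "norm (q n t) \<le> L" for n t
  proof -
    have "norm (q n t) = real (Suc n) * norm (F (t + 1 / real (Suc n)) - F t)"
      unfolding q_def by simp
    also have "\<dots> \<le> real (Suc n) * (L * \<bar>t + 1 / real (Suc n) - t\<bar>)"
      by (intro mult_left_mono F_lip) simp
    also have "\<dots> = L" by (simp add: field_simps)
    finally show ?thesis .
  qed
  have q_lim: "(\<lambda>n. q n t) \<longlonglongrightarrow> D t" if "t \<in> {a..b}" "t \<notin> N" for t
  proof -
    have t: "a < t" "t < b" "(f has_vector_derivative D t) (at t within {a..b})"
      using that unfolding N_def by auto
    then have "(f has_vector_derivative D t) (at t)"
      by (simp add: at_within_Icc_at)
    then have "(F has_vector_derivative D t) (at t)"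
      by (rule has_vector_derivative_transform_within_open[of _ _ _ "{a<..<b}"])
         (use t in \<open>auto simp: F_def\<close>)
    from difference_quotient_sequence[OF this] show ?thesis unfolding q_def .
  qed
  have q_cont: "continuous_on A (q n)" for A n
    unfolding q_def
    by (intro continuous_intros continuous_on_compose2[OF F_cont]) auto
  \<comment> \<open>The dominated convergence theorem asks for convergence at every point, so all functions are set
    to 0 on the exceptional set.\<close>
  define Q where "Q n t = (if t \<in> N then 0 else q n t)" for n t
  define E where "E t = (if t \<in> N then 0 else D t)" for t
  have Q_eq: "(Q n has_integral integral {a..b} (q n)) {a..b}" for n
    by (rule has_integral_spike[OF N, of _ _ "q n"])
       (auto simp: Q_def intro!: integrable_integral integrable_continuous_real q_cont)
  have dom: "E integrable_on {a..b}" "(\<lambda>n. integral {a..b} (Q n)) \<longlonglongrightarrow> integral {a..b} E"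
  proof -
    have 1: "Q n integrable_on {a..b}" for n using Q_eq by blast
    have 2: "(\<lambda>t. L) integrable_on {a..b}" by (rule integrable_const_ivl)
    have 3: "norm (Q n t) \<le> L" for n t using q_bound L0 by (simp add: Q_def)
    have 4: "(\<lambda>n. Q n t) \<longlonglongrightarrow> E t" if "t \<in> {a..b}" for t
      using q_lim[OF that] by (simp add: Q_def E_def)
    show "E integrable_on {a..b}" "(\<lambda>n. integral {a..b} (Q n)) \<longlonglongrightarrow> integral {a..b} E"
      using dominated_convergence[OF 1 2 3 4] by auto
  qed
  \<comment> \<open>After the substitution \<open>t + h\<close> only the integrals over the two end intervals of length \<open>h\<close> remain.\<close>
  have int_q: "norm (integral {a..b} (q n) - (f b - f a)) \<le> L / real (Suc n)" for n
  proof -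
    define h where "h = 1 / real (Suc n)"
    have h: "h > 0" unfolding h_def by simp
    have int: "F integrable_on {s..t}" for s t
      by (intro integrable_continuous_real continuous_on_subset[OF F_cont]) simp
    have "integral {a..b} (q n) = real (Suc n) *\<^sub>R integral {a..b} (\<lambda>t. F (t + h) - F t)"
      unfolding q_def h_def by (simp only: integral_cmul)
    also have "integral {a..b} (\<lambda>t. F (t + h) - F t) = integral {a + h..b + h} F - integral {a..b} F"
      by (subst integral_diff)
         (auto intro!: integrable_continuous_real continuous_intros continuous_on_compose2[OF F_cont]
           simp: integral_shift_Icc[OF F_cont])
    also have "\<dots> = integral {b..b + h} F - integral {a..a + h} F"
    proof -
      have "integral {a..b} F + integral {b..b + h} F = integral {a..b + h} F"
        using h \<open>a \<le> b\<close> by (intro Henstock_Kurzweil_Integration.integral_combine int) auto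
      moreover have "integral {a..a + h} F + integral {a + h..b + h} F = integral {a..b + h} F"
        using h \<open>a \<le> b\<close> by (intro Henstock_Kurzweil_Integration.integral_combine int) auto
      ultimately show ?thesis by (simp add: algebra_simps)
    qed
    also have "integral {b..b + h} F = h *\<^sub>R f b"
    proof -
      have "integral {b..b + h} F = integral {b..b + h} (\<lambda>_. f b)"
        by (intro integral_cong) (use \<open>a \<le> b\<close> in \<open>auto simp: F_def\<close>)
      then show ?thesis using h by simp
    qed
    finally have *: "integral {a..b} (q n) - (f b - f a)
        = - real (Suc n) *\<^sub>R (integral {a..a + h} F - h *\<^sub>R f a)"
    proof -
      assume "integral {a..b} (q n) = real (Suc n) *\<^sub>R (h *\<^sub>R f b - integral {a..a + h} F)"
      moreover have "real (Suc n) * h = 1" by (simp add: h_def)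
      ultimately show ?thesis by (simp add: scaleR_diff_right del: of_nat_Suc)
    qed
    have "norm (integral {a..a + h} F - h *\<^sub>R f a) = norm (integral {a..a + h} (\<lambda>t. F t - f a))"
      by (subst integral_diff) (use h in \<open>auto intro!: int\<close>)
    also have "\<dots> \<le> (L * h) * (a + h - a)"
    proof (rule integral_bound)
      show "continuous_on {a..a + h} (\<lambda>t. F t - f a)"
        by (intro continuous_intros continuous_on_subset[OF F_cont]) auto
      show "norm (F t - f a) \<le> L * h" if "t \<in> {a..a + h}" for t
      proof -
        have "F a = f a" using \<open>a \<le> b\<close> by (simp add: F_def)
        then have "norm (F t - f a) \<le> L * \<bar>t - a\<bar>" using F_lip[of t a] by simp
        also have "\<dots> \<le> L * h" using that by (intro mult_left_mono L0) auto
        finally show ?thesis .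
      qed
    qed (use h in auto)
    finally have "norm (integral {a..b} (q n) - (f b - f a)) \<le> real (Suc n) * ((L * h) * h)"
      unfolding * by (simp del: of_nat_Suc)
    also have "\<dots> = (real (Suc n) * h) * (L * h)" by (simp only: mult_ac)
    also have "\<dots> = L / real (Suc n)" by (simp add: h_def)
    finally show ?thesis .
  qed
  have "(\<lambda>n. integral {a..b} (q n) - (f b - f a)) \<longlonglongrightarrow> 0"
    by (rule Lim_null_comparison[of _ "\<lambda>n. L / real (Suc n)"])
       (auto intro!: always_eventually int_q real_tendsto_divide_at_top
         filterlim_compose[OF filterlim_real_sequentially filterlim_Suc] simp del: of_nat_Suc)
  then have "(\<lambda>n. integral {a..b} (q n)) \<longlonglongrightarrow> f b - f a"
    by (simp only: LIM_zero_iff)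
  moreover have "integral {a..b} (Q n) = integral {a..b} (q n)" for n
    using Q_eq by (rule integral_unique)
  ultimately have "integral {a..b} E = f b - f a"
    using dom(2) by (simp add: LIMSEQ_unique)
  then have "(E has_integral f b - f a) {a..b}"
    using dom(1) by (simp add: has_integral_integral)
  then show "(D has_integral f b - f a) {a..b}"
    by (rule has_integral_spike[OF N, rotated]) (simp add: E_def)
  show "AE t in lebesgue. t \<in> {a..b} \<longrightarrow> norm (D t) \<le> L"
    unfolding AE_lebesgue_negligible
  proof (rule negligible_subset[OF N], rule subsetI)
    fix t assume "t \<in> {t. \<not> (t \<in> {a..b} \<longrightarrow> norm (D t) \<le> L)}"
    then have t: "t \<in> {a..b}" "\<not> norm (D t) \<le> L" by auto
    show "t \<in> N"
    proof (rule ccontr)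
      assume "t \<notin> N"
      from tendsto_norm[OF q_lim[OF t(1) this]] have "norm (D t) \<le> L"
        by (rule LIMSEQ_le_const2) (use q_bound in blast)
      with t(2) show False ..
    qed
  qed
qed

text \<open>The measures on the line with densities \<open>f\<close> and 1 on \<open>{a..b}\<close> agree on all half-lines, hence are
  equal, and densities with respect to a sigma-finite measure are unique almost everywhere.\<close>

lemma eq_1_AE_if_indefinite_integral_id:
  fixes f :: "real \<Rightarrow> real"
  assumes nonneg: "\<And>t. f t \<ge> 0"
    and int: "f integrable_on {a..b}"
    and id: "\<And>t. t \<in> {a..b} \<Longrightarrow> integral {a..t} f = t - a"
  shows "AE t in lebesgue. t \<in> {a..b} \<longrightarrow> f t = 1"
proof -
  define F where "F t = indicator {a..b} t * f t" for t
  have hasint: "(f has_integral max 0 (b - max a x)) ({x<..} \<inter> {a..b})" for x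
  proof (cases "a \<le> b \<and> x \<le> b")
    case True
    have 1: "(f has_integral integral {max a x..b} f) {max a x..b}"
      by (intro integrable_integral integrable_subinterval_real[OF int]) auto
    have "integral {a..max a x} f + integral {max a x..b} f = integral {a..b} f"
      using True by (intro Henstock_Kurzweil_Integration.integral_combine int) auto
    then have "integral {max a x..b} f = b - max a x"
      using id[of b] id[of "max a x"] True by auto
    with 1 have "(f has_integral max 0 (b - max a x)) {max a x..b}" using True by simp
    moreover have "(f has_integral y) {max a x..b} \<longleftrightarrow> (f has_integral y) ({x<..} \<inter> {a..b})" for y
      by (rule has_integral_spike_set_eq; rule negligible_subset[of "{x}"]) auto
    ultimately show ?thesis by simp
  next
    case False
    then have "{x<..} \<inter> {a..b} = {}" "max 0 (b - max a x) = 0" by auto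
    then show ?thesis by simp
  qed
  \<comment> \<open>Density measures are formed over the Borel sets, so \<open>f\<close> is replaced by a Borel function \<open>G\<close>.\<close>
  have "F \<in> borel_measurable lebesgue"
    using int nonneg nonnegative_absolutely_integrable_1[OF int] unfolding F_def
    by (auto simp: set_integrable_def dest!: borel_measurable_integrable)
  then obtain G where G[measurable]: "G \<in> borel_measurable lborel" and FG: "AE t in lborel. F t = G t"
    using completion_ex_borel_measurable_real by blast
  define M1 where "M1 = density lborel (\<lambda>t. ennreal (G t))"
  define M2 where "M2 = density lborel (\<lambda>t. indicator {a..b} t :: ennreal)"
  have e1: "emeasure M1 {x<..} = ennreal (max 0 (b - max a x))" for x
  proof -
    have "emeasure M1 {x<..} = (\<integral>\<^sup>+t. ennreal (G t) * indicator {x<..} t \<partial>lborel)"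
      unfolding M1_def by (intro emeasure_density) auto
    also have "\<dots> = (\<integral>\<^sup>+t. ennreal (F t) * indicator {x<..} t \<partial>lborel)"
      using FG by (intro nn_integral_cong_AE) auto
    also have "\<dots> = (\<integral>\<^sup>+t. indicator ({x<..} \<inter> {a..b}) t * f t \<partial>lborel)"
      by (intro nn_integral_cong) (auto simp: F_def split: split_indicator)
    also have "\<dots> = ennreal (max 0 (b - max a x))"
      using nn_integral_has_integral_lebesgue[OF nonneg hasint] by (simp add: nn_integral_completion)
    finally show ?thesis .
  qed
  have e2: "emeasure M2 {x<..} = ennreal (max 0 (b - max a x))" for x
  proof -
    have "emeasure M2 {x<..} = (\<integral>\<^sup>+t. indicator {a..b} t * indicator {x<..} t \<partial>lborel)"
      unfolding M2_def by (intro emeasure_density) auto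
    also have "\<dots> = (\<integral>\<^sup>+t. indicator ({x<..} \<inter> {a..b}) t \<partial>lborel)"
      by (intro nn_integral_cong) (auto split: split_indicator)
    also have "\<dots> = emeasure lborel ({x<..} \<inter> {a..b})" by simp
    also have "\<dots> = ennreal (max 0 (b - max a x))"
    proof (cases "x < a")
      case True
      then have "{x<..} \<inter> {a..b} = {a..b}" by auto
      then show ?thesis using True by (auto simp: max_def emeasure_lborel_Icc_eq)
    next
      case False
      then have "{x<..} \<inter> {a..b} = {x<..b}" by auto
      then show ?thesis using False by (cases "x \<le> b") (auto simp: max_def)
    qed
    finally show ?thesis .
  qed
  have "M1 = M2"
    by (rule measure_eqI_lessThan) (simp_all add: e1 e2, simp_all add: M1_def M2_def)
  then have "AE t in lborel. ennreal (G t) = indicator {a..b} t"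
    unfolding M1_def M2_def by (intro sigma_finite_measure.density_unique[OF sigma_finite_lborel]) auto
  with FG have "AE t in lborel. t \<in> {a..b} \<longrightarrow> f t = 1"
    by eventually_elim (auto simp: F_def)
  then show ?thesis by (rule AE_completion)
qed

section \<open>Hermitian matrices and their exponentials\<close>

lemma cmat_eq_iff:
  fixes A B :: cmat
  shows "A = B \<longleftrightarrow> A$1$1 = B$1$1 \<and> A$1$2 = B$1$2 \<and> A$2$1 = B$2$1 \<and> A$2$2 = B$2$2"
  by (simp add: vec_eq_iff forall_2)

lemma matrix_mult_entries:
  fixes A B :: cmat
  shows "(A ** B) $ i $ j = A$i$1 * B$1$j + A$i$2 * B$2$j"
  by (simp add: matrix_matrix_mult_def sum_2)

lemma mat_1_entries [simp]:
  "(mat 1 :: cmat) $ 1 $ 1 = 1" "(mat 1 :: cmat) $ 1 $ 2 = 0"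
  "(mat 1 :: cmat) $ 2 $ 1 = 0" "(mat 1 :: cmat) $ 2 $ 2 = 1"
  by (simp_all add: mat_def)

lemma norm_cmat_power2:
  "(norm (A :: cmat))\<^sup>2 = (cmod (A$1$1))\<^sup>2 + (cmod (A$1$2))\<^sup>2 + (cmod (A$2$1))\<^sup>2 + (cmod (A$2$2))\<^sup>2"
  by (simp add: norm_vec_def L2_set_def sum_2)

lemma norm_mat_1_le: "norm (mat 1 :: cmat) \<le> 2"
proof -
  have "norm (mat 1 :: cmat) = sqrt 2"
    using norm_cmat_power2[of "mat 1"] by (simp add: real_sqrt_unique)
  then show ?thesis using sqrt2_less_2 by linarith
qed

lemma norm_matrix_mult_le:
  fixes A B :: cmat
  shows "norm (A ** B) \<le> norm A * norm B"
proof -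
  have *: "(cmod (a * c + b * d))\<^sup>2 \<le> ((cmod a)\<^sup>2 + (cmod b)\<^sup>2) * ((cmod c)\<^sup>2 + (cmod d)\<^sup>2)" for a b c d
  proof -
    have "(cmod (a * c + b * d))\<^sup>2 \<le> (cmod a * cmod c + cmod b * cmod d)\<^sup>2"
      by (intro power_mono) (simp_all add: norm_mult norm_triangle_le)
    also have "\<dots> \<le> ((cmod a)\<^sup>2 + (cmod b)\<^sup>2) * ((cmod c)\<^sup>2 + (cmod d)\<^sup>2)"
      using zero_le_power2[of "cmod a * cmod d - cmod b * cmod c"]
      by (simp add: power2_eq_square algebra_simps)
    finally show ?thesis .
  qed
  have "(norm (A ** B))\<^sup>2 \<le> (norm A)\<^sup>2 * (norm B)\<^sup>2"
    unfolding norm_cmat_power2 matrix_mult_entries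
    using *[of "A$1$1" "B$1$1" "A$1$2" "B$2$1"] *[of "A$1$1" "B$1$2" "A$1$2" "B$2$2"]
      *[of "A$2$1" "B$1$1" "A$2$2" "B$2$1"] *[of "A$2$1" "B$1$2" "A$2$2" "B$2$2"]
    by (simp add: algebra_simps)
  then show ?thesis
    by (metis norm_ge_zero mult_nonneg_nonneg power2_le_imp_le power_mult_distrib)
qed

lemma bounded_bilinear_matrix_mult: "bounded_bilinear ((**) :: cmat \<Rightarrow> cmat \<Rightarrow> cmat)"
proof (rule bounded_bilinear.intro)
  show "\<exists>K. \<forall>(A :: cmat) (B :: cmat). norm (A ** B) \<le> norm A * norm B * K"
    by (rule exI[of _ 1]) (simp add: norm_matrix_mult_le)
qed (simp_all add: cmat_eq_iff matrix_mult_entries algebra_simps)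

interpretation matrix_mult: bounded_bilinear "(**) :: cmat \<Rightarrow> cmat \<Rightarrow> cmat"
  by (rule bounded_bilinear_matrix_mult)

lemma H_iff: "h \<in> H \<longleftrightarrow> Im (h$1$1) = 0 \<and> Im (h$2$2) = 0 \<and> h$2$1 = cnj (h$1$2)"
proof
  assume "h \<in> H"
  then show "Im (h$1$1) = 0 \<and> Im (h$2$2) = 0 \<and> h$2$1 = cnj (h$1$2)"
    by (subst (1 2 3 4) H_expansion) (simp_all add: e0_def e1_def e2_def e3_def complex_eq_iff)
next
  assume "Im (h$1$1) = 0 \<and> Im (h$2$2) = 0 \<and> h$2$1 = cnj (h$1$2)"
  then have "h = x0 h *\<^sub>R e0 + x1 h *\<^sub>R e1 + x2 h *\<^sub>R e2 + x3 h *\<^sub>R e3"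
    by (simp add: cmat_eq_iff complex_eq_iff e0_def e1_def e2_def e3_def x0_def x1_def x2_def x3_def
        field_simps)
  also have "\<dots> \<in> H"
    unfolding H_def by (intro span_add span_scale span_base) auto
  finally show "h \<in> H" .
qed

lemma H0_subset_H: "H0 \<subseteq> H"
  unfolding H0_def H_def by (rule span_mono) auto

lemma H0_iff: "h \<in> H0 \<longleftrightarrow> Im (h$1$1) = 0 \<and> h$2$2 = - h$1$1 \<and> h$2$1 = cnj (h$1$2)"
proof
  assume h: "h \<in> H0"
  have "x0 h = 0"
    using h unfolding H0_def
    by (induction rule: span_induct_alt) (auto simp: x0_def e1_def e2_def e3_def)
  moreover have "h \<in> H" using h H0_subset_H by blast
  ultimately show "Im (h$1$1) = 0 \<and> h$2$2 = - h$1$1 \<and> h$2$1 = cnj (h$1$2)"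
    unfolding H_iff by (auto simp: x0_def complex_eq_iff)
next
  assume *: "Im (h$1$1) = 0 \<and> h$2$2 = - h$1$1 \<and> h$2$1 = cnj (h$1$2)"
  then have "h = x1 h *\<^sub>R e1 + x2 h *\<^sub>R e2 + x3 h *\<^sub>R e3"
    by (simp add: cmat_eq_iff complex_eq_iff e1_def e2_def e3_def x1_def x2_def x3_def field_simps)
  also have "\<dots> \<in> H0"
    unfolding H0_def by (intro span_add span_scale span_base) auto
  finally show "h \<in> H0" .
qed

lemma subspace_H0: "subspace H0"
  by (simp add: H0_def)

lemma H_decomposition:
  assumes "h \<in> H"
  shows "h - x0 h *\<^sub>R e0 \<in> H0" "x1 (h - x0 h *\<^sub>R e0) = x1 h" "x2 (h - x0 h *\<^sub>R e0) = x2 h"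
    "x3 (h - x0 h *\<^sub>R e0) = x3 h"
  using assms unfolding H_iff H0_iff
  by (auto simp: e0_def x0_def x1_def x2_def x3_def complex_eq_iff field_simps)

lemma sqrt_scal_prod_H0:
  assumes "h \<in> H0"
  shows "sqrt (scal_prod h h) = sqrt 2 * norm h"
proof -
  have "scal_prod h h = 2 * (norm h)\<^sup>2"
    using assms unfolding H0_iff norm_cmat_power2 cmod_power2
    by (simp add: scal_prod_def x1_def x2_def x3_def complex_eq_iff power2_eq_square algebra_simps)
  then show ?thesis by (simp add: real_sqrt_mult)
qed

lemma H0_square:
  assumes "h \<in> H0"
  shows "h ** h = ((norm h)\<^sup>2 / 2) *\<^sub>R mat 1"
  using assms unfolding H0_iff norm_cmat_power2 cmod_power2
  by (simp add: cmat_eq_iff matrix_mult_entries complex_eq_iff power2_eq_square algebra_simps)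

text \<open>For \<open>p \<in> H0\<close> this is the matrix exponential of \<open>t p\<close>: since \<open>p ** p\<close> is a scalar matrix, the
  exponential series sums to hyperbolic functions. At \<open>p = 0\<close> the undefined quotient is harmless,
  because it multiplies \<open>p\<close>.\<close>

definition hexp_line :: "cmat \<Rightarrow> real \<Rightarrow> cmat"
  where "hexp_line p t = (let r = norm p / sqrt 2 in cosh (t * r) *\<^sub>R mat 1 + (sinh (t * r) / r) *\<^sub>R p)"

definition hexp :: "cmat \<Rightarrow> cmat"
  where "hexp p = hexp_line p 1"

lemma hexp_line_0 [simp]: "hexp_line p 0 = mat 1"
  by (simp add: hexp_line_def)

lemma hexp_line_derivative:
  assumes "p \<in> H0"
  shows "(hexp_line p has_vector_derivative (hexp_line p t ** p)) (at t within A)"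
proof (cases "p = 0")
  case True
  then show ?thesis by (simp add: hexp_line_def[abs_def])
next
  case False
  define r where "r = norm p / sqrt 2"
  have r: "r \<noteq> 0" "(norm p)\<^sup>2 / 2 = r\<^sup>2" using False by (simp_all add: r_def power_divide)
  have "((\<lambda>t. cosh (t * r) *\<^sub>R mat 1 + (sinh (t * r) / r) *\<^sub>R p) has_vector_derivative
      (sinh (t * r) * r) *\<^sub>R mat 1 + (cosh (t * r) * r / r) *\<^sub>R p) (at t within A)"
    by (auto intro!: derivative_eq_intros)
  moreover have "(cosh (t * r) *\<^sub>R mat 1 + (sinh (t * r) / r) *\<^sub>R p) ** p
      = (sinh (t * r) * r) *\<^sub>R mat 1 + (cosh (t * r) * r / r) *\<^sub>R p"
    using r by (simp add: matrix_mult.add_left matrix_mult.scaleR_left H0_square[OF assms] power2_eq_square)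
  ultimately show ?thesis
    unfolding hexp_line_def Let_def r_def[symmetric] by simp
qed

lemma hexp_line_SL2:
  assumes "p \<in> H0"
  shows "hexp_line p t \<in> SL2"
proof -
  define r where "r = norm p / sqrt 2"
  have det: "det (c *\<^sub>R mat 1 + s *\<^sub>R p) = of_real (c\<^sup>2 - s\<^sup>2 * r\<^sup>2)" for c s :: real
    using assms unfolding H0_iff r_def power_divide norm_cmat_power2 cmod_power2
    by (simp add: det_2 complex_eq_iff power2_eq_square algebra_simps)
  have "(sinh (t * r) / r)\<^sup>2 * r\<^sup>2 = (sinh (t * r))\<^sup>2"
    by (cases "r = 0") (simp_all add: power_divide)
  then show ?thesis
    unfolding hexp_line_def Let_def r_def[symmetric] SL2_def mem_Collect_eq det
    by (simp only: hyperbolic_pythagoras of_real_1)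
qed

lemma SL2_mult: "A \<in> SL2 \<Longrightarrow> B \<in> SL2 \<Longrightarrow> A ** B \<in> SL2"
  by (simp add: SL2_def det_mul)

lemma mat_1_SL2 [simp]: "mat 1 \<in> SL2"
  by (simp add: SL2_def)

definition adjugate :: "cmat \<Rightarrow> cmat"
  where "adjugate A = vector [vector [A$2$2, - A$1$2], vector [- A$2$1, A$1$1]]"

lemma adjugate_entries [simp]:
  "adjugate A $ 1 $ 1 = A$2$2" "adjugate A $ 1 $ 2 = - A$1$2"
  "adjugate A $ 2 $ 1 = - A$2$1" "adjugate A $ 2 $ 2 = A$1$1"
  by (simp_all add: adjugate_def)

lemma adjugate_SL2:
  assumes "A \<in> SL2"
  shows "adjugate A \<in> SL2" "adjugate A ** A = mat 1" "A ** adjugate A = mat 1"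
  using assms by (simp_all add: SL2_def det_2 cmat_eq_iff matrix_mult_entries algebra_simps)

lemma norm_adjugate [simp]: "norm (adjugate A) = norm A"
proof -
  have "(norm (adjugate A))\<^sup>2 = (norm A)\<^sup>2" by (simp add: norm_cmat_power2)
  then show ?thesis by simp
qed

lemma norm_hexp_minus_le:
  assumes "norm p \<le> 1"
  shows "norm (hexp p - mat 1 - p) \<le> 2 * (norm p)\<^sup>2"
proof -
  define r where "r = norm p / sqrt 2"
  have "norm p / sqrt 2 \<le> norm p / 1" by (intro divide_left_mono) auto
  then have r: "0 \<le> r" "r \<le> 1" using assms unfolding r_def by (simp, linarith)
  have e1: "exp r \<le> 1 + r + r\<^sup>2" by (rule exp_bound) (use r in auto)
  have e2: "exp (- r) \<ge> 1 - r" using exp_ge_add_one_self[of "- r"] by simp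
  have e3: "exp r \<ge> 1 + r" by (rule exp_ge_add_one_self)
  have e4: "exp (- r) \<le> 1 - r + r\<^sup>2"
  proof -
    have "(1 + r) * (1 - r + r\<^sup>2) = 1 + r ^ 3" by (simp add: power2_eq_square power3_eq_cube algebra_simps)
    then have "1 / (1 + r) \<le> 1 - r + r\<^sup>2" using r by (simp add: divide_le_eq mult.commute)
    moreover have "exp (- r) \<le> 1 / (1 + r)" using e3 r by (simp add: exp_minus field_simps)
    ultimately show ?thesis by linarith
  qed
  have c: "\<bar>cosh r - 1\<bar> \<le> r\<^sup>2"
  proof -
    have "cosh r = (exp r + exp (- r)) / 2" by (simp add: cosh_def)
    moreover have "exp r + exp (- r) \<le> (1 + r + r\<^sup>2) + (1 - r + r\<^sup>2)"
      by (rule add_mono[OF e1 e4])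
    ultimately have "cosh r - 1 \<le> r\<^sup>2" by simp
    then show ?thesis using cosh_real_ge_1[of r] by simp
  qed
  have s: "\<bar>sinh r - r\<bar> \<le> r\<^sup>2"
  proof -
    have "sinh r = (exp r - exp (- r)) / 2" by (simp add: sinh_def)
    moreover have "exp r - exp (- r) \<le> (1 + r + r\<^sup>2) - (1 - r)" by (rule diff_mono[OF e1 e2])
    moreover have "exp r - exp (- r) \<ge> (1 + r) - (1 - r + r\<^sup>2)" by (rule diff_mono[OF e3 e4])
    moreover have "r\<^sup>2 \<ge> 0" by simp
    ultimately show ?thesis by (simp add: abs_le_iff)
  qed
  have p: "(sinh r / r) *\<^sub>R p - p = ((sinh r - r) / r) *\<^sub>R p"
  proof (cases "p = 0")
    case False
    then have "r \<noteq> 0" by (simp add: r_def)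
    then have "(sinh r - r) / r = sinh r / r - 1" by (simp add: diff_divide_distrib)
    then show ?thesis by (simp add: scaleR_left_diff_distrib)
  qed simp
  have "hexp p - mat 1 - p = (cosh r - 1) *\<^sub>R mat 1 + ((sinh r - r) / r) *\<^sub>R p"
    using p by (simp add: hexp_def hexp_line_def Let_def r_def[symmetric] algebra_simps)
  then have "norm (hexp p - mat 1 - p) \<le> norm ((cosh r - 1) *\<^sub>R (mat 1 :: cmat)) + norm (((sinh r - r) / r) *\<^sub>R p)"
    by (metis norm_triangle_ineq)
  also have "norm ((cosh r - 1) *\<^sub>R (mat 1 :: cmat)) \<le> r\<^sup>2 * 2"
    unfolding norm_scaleR by (intro mult_mono norm_mat_1_le) (use c in auto)
  also have "norm (((sinh r - r) / r) *\<^sub>R p) = \<bar>sinh r - r\<bar> * sqrt 2 * (norm p / sqrt 2 / \<bar>r\<bar>)"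
    by simp
  also have "\<dots> \<le> \<bar>sinh r - r\<bar> * sqrt 2 * 1"
    by (intro mult_left_mono) (auto simp: r_def)
  also have "\<dots> \<le> r\<^sup>2 * 2"
    using mult_mono[OF s, of "sqrt 2" 2] sqrt2_less_2 by simp
  finally show ?thesis by (simp add: r_def power_divide)
qed

section \<open>Concatenation of horizontal paths\<close>

text \<open>The paths admitted in the infimum that defines \<open>rho\<close>, together with the integrability of their
  speed; the latter makes lengths add up under concatenation.\<close>

definition reachable :: "real \<Rightarrow> cmat \<Rightarrow> bool"
  where "reachable l h \<longleftrightarrow> (\<exists>a g u. 0 < a \<and> piecewise_C1 0 a g \<and> g ` {0..a} \<subseteq> SL2 \<and>
    left_control H0 0 a g u \<and> (\<lambda>t. sqrt (scal_prod (u t) (u t))) integrable_on {0..a} \<and>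
    g 0 = mat 1 \<and> g a = h \<and> scal_length 0 a u = l)"

lemma scal_prod_nonneg: "scal_prod h h \<ge> 0"
  by (simp add: scal_prod_def)

lemma scal_length_nonneg: "scal_length a b u \<ge> 0"
  unfolding scal_length_def
  by (cases "(\<lambda>t. sqrt (scal_prod (u t) (u t))) integrable_on {a..b}")
     (auto intro: integral_nonneg simp: scal_prod_nonneg not_integrable_integral)

lemma rho_le_reachable:
  assumes "reachable l h"
  shows "rho (mat 1) h \<le> l"
  unfolding rho_def
proof (rule cInf_lower)
  show "bdd_below {scal_length 0 a u | a g u.
           0 < a \<and> piecewise_C1 0 a g \<and> g ` {0..a} \<subseteq> SL2 \<and> left_control H0 0 a g u \<and>
           g 0 = mat 1 \<and> g a = h}"
    by (rule bdd_belowI[of _ 0]) (auto simp: scal_length_nonneg)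
qed (use assms in \<open>unfold reachable_def, blast\<close>)

lemma reachable_mat_1: "reachable 0 (mat 1)"
proof -
  have C1: "piecewise_C1 0 1 (\<lambda>t. mat 1)"
    unfolding piecewise_C1_def
    by (rule exI[of _ 1], rule exI[of _ real]) (auto intro!: exI[of _ "\<lambda>_. 0"])
  have ctrl: "left_control H0 0 1 (\<lambda>t. mat 1) (\<lambda>t. 0)"
    unfolding left_control_def by (simp add: subspace_0[OF subspace_H0])
  show ?thesis
    unfolding reachable_def
    by (rule exI[of _ 1], rule exI[of _ "\<lambda>t. mat 1"], rule exI[of _ "\<lambda>t. 0"])
       (use C1 ctrl in \<open>auto simp: scal_length_def scal_prod_def x1_def x2_def x3_def\<close>)
qed

lemma piecewise_C1_append:
  assumes g: "piecewise_C1 a b g" and "b < c" and D: "continuous_on {b..c} D"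
    and h: "\<And>t. t \<in> {b..c} \<Longrightarrow> (h has_vector_derivative D t) (at t within {b..c})"
    and "g b = h b"
  shows "piecewise_C1 a c (\<lambda>t. if t \<le> b then g t else h t)"
proof -
  let ?f = "\<lambda>t. if t \<le> b then g t else h t"
  from g obtain n p where p: "p 0 = a" "p n = b" "\<And>i. i < n \<Longrightarrow> p i < p (Suc i)"
    and C1: "\<And>i. i < n \<Longrightarrow> \<exists>D. continuous_on {p i..p (Suc i)} D \<and>
       (\<forall>t\<in>{p i..p (Suc i)}. (g has_vector_derivative D t) (at t within {p i..p (Suc i)}))"
    unfolding piecewise_C1_def by blast
  define q where "q i = (if i \<le> n then p i else c)" for i
  have le: "p i \<le> b" if "i \<le> n" for i
    using that
  proof (induction rule: inc_induct)
    case (step k) then show ?case using p(3)[of k] by linarith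
  qed (simp add: p)
  show ?thesis
    unfolding piecewise_C1_def
  proof (rule exI[of _ "Suc n"], rule exI[of _ q], intro conjI allI impI)
    fix i assume i: "i < Suc n"
    show "q i < q (Suc i)" using i p \<open>b < c\<close> by (auto simp: q_def less_Suc_eq)
    show "\<exists>D. continuous_on {q i..q (Suc i)} D \<and>
      (\<forall>t\<in>{q i..q (Suc i)}. (?f has_vector_derivative D t) (at t within {q i..q (Suc i)}))"
    proof (cases "i < n")
      case True
      then have q: "q i = p i" "q (Suc i) = p (Suc i)" by (auto simp: q_def)
      from C1[OF True] obtain E where E: "continuous_on {p i..p (Suc i)} E"
        "\<And>t. t \<in> {p i..p (Suc i)} \<Longrightarrow> (g has_vector_derivative E t) (at t within {p i..p (Suc i)})"
        by blast
      have "(?f has_vector_derivative E t) (at t within {p i..p (Suc i)})" if "t \<in> {p i..p (Suc i)}" for t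
        by (rule has_vector_derivative_transform[OF that _ E(2)[OF that]])
           (use le[of "Suc i"] True in auto)
      then show ?thesis unfolding q using E(1) by blast
    next
      case False
      then have "i = n" using i by simp
      then have q: "q i = b" "q (Suc i) = c" using p by (auto simp: q_def)
      have "(?f has_vector_derivative D t) (at t within {b..c})" if "t \<in> {b..c}" for t
        by (rule has_vector_derivative_transform[OF that _ h[OF that]])
           (use \<open>g b = h b\<close> in auto)
      then show ?thesis unfolding q using D by blast
    qed
  qed (use p in \<open>auto simp: q_def\<close>)
qed

text \<open>A path to \<open>h\<close> is prolonged for unit time with the constant control \<open>p\<close>, along the left translate
  by \<open>h\<close> of the one-parameter group of \<open>p\<close>.\<close>

lemma reachable_hexp:
  assumes "reachable l h" and p: "p \<in> H0"
  shows "reachable (l + sqrt 2 * norm p) (h ** hexp p)"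
proof -
  from assms(1) obtain a g u where a: "0 < a" and g: "piecewise_C1 0 a g" "g ` {0..a} \<subseteq> SL2"
    and u: "left_control H0 0 a g u" and int: "(\<lambda>t. sqrt (scal_prod (u t) (u t))) integrable_on {0..a}"
    and g0: "g 0 = mat 1" and ga: "g a = h" and l: "scal_length 0 a u = l"
    unfolding reachable_def by blast
  define k where "k t = h ** hexp_line p (t - a)" for t
  have ka: "k a = h" by (simp add: k_def)
  have k': "(k has_vector_derivative (k t ** p)) (at t within A)" for t A
  proof -
    have "((\<lambda>t. t - a) has_vector_derivative 1) (at t within A)"
      by (auto intro!: derivative_eq_intros)
    from vector_diff_chain_within[OF this hexp_line_derivative[OF p]]
    have "((\<lambda>t. hexp_line p (t - a)) has_vector_derivative 1 *\<^sub>R (hexp_line p (t - a) ** p)) (at t within A)"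
      by (simp add: o_def)
    then have "((\<lambda>t. h ** hexp_line p (t - a)) has_vector_derivative
        h ** (1 *\<^sub>R (hexp_line p (t - a) ** p))) (at t within A)"
      by (rule bounded_linear.has_vector_derivative[OF matrix_mult.bounded_linear_right])
    then show ?thesis unfolding k_def[abs_def] by (simp add: matrix_mul_assoc)
  qed
  define f where "f t = (if t \<le> a then g t else k t)" for t
  define w where "w t = (if t \<le> a then u t else p)" for t
  have k_cont: "continuous_on A k" for A
    by (rule continuous_on_vector_derivative, rule k')
  have C1: "piecewise_C1 0 (a + 1) f"
    unfolding f_def[abs_def]
    by (rule piecewise_C1_append[OF g(1), where D = "\<lambda>t. k t ** p"])
       (auto intro!: k' continuous_intros k_cont matrix_mult.continuous_on simp: ka ga)
  have SL2: "f ` {0..a + 1} \<subseteq> SL2"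
    using g(2) ga a by (auto simp: f_def k_def intro!: SL2_mult hexp_line_SL2 p)
  have ctrl: "left_control H0 0 (a + 1) f w"
    unfolding left_control_def AE_lebesgue_negligible
  proof (rule negligible_subset)
    show "negligible ({t. \<not> (t \<in> {0..a} \<longrightarrow> u t \<in> H0 \<and>
        (g has_vector_derivative g t ** u t) (at t within {0..a}))} \<union> {a})"
      using u unfolding left_control_def AE_lebesgue_negligible by simp
    have "w t \<in> H0 \<and> (f has_vector_derivative f t ** w t) (at t within {0..a + 1})"
      if t: "t \<in> {0..a + 1}" "t \<noteq> a" and
        u: "t \<in> {0..a} \<longrightarrow> u t \<in> H0 \<and> (g has_vector_derivative g t ** u t) (at t within {0..a})" for t
    proof (cases "t < a")
      case True
      have "at t within {0..a + 1} = at t within {0..a}"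
        by (rule at_within_nhd[of _ "{..<a}"]) (use True a in auto)
      moreover have "(f has_vector_derivative g t ** u t) (at t within {0..a})"
        by (rule has_vector_derivative_transform[of _ _ _ g]) (use True t u in \<open>auto simp: f_def\<close>)
      ultimately show ?thesis using True t u by (simp add: f_def w_def)
    next
      case False
      then have ta: "a < t" using t by simp
      have "(f has_vector_derivative k t ** p) (at t)"
        by (rule has_vector_derivative_transform_within_open[OF k', of "{a<..}"])
           (use ta in \<open>auto simp: f_def\<close>)
      then show ?thesis using ta p by (simp add: f_def w_def has_vector_derivative_at_within)
    qed
    then show "{t. \<not> (t \<in> {0..a + 1} \<longrightarrow> w t \<in> H0 \<and> (f has_vector_derivative f t ** w t) (at t within {0..a + 1}))}
      \<subseteq> {t. \<not> (t \<in> {0..a} \<longrightarrow> u t \<in> H0 \<and> (g has_vector_derivative g t ** u t) (at t within {0..a}))} \<union> {a}"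
      by blast
  qed
  have len: "((\<lambda>t. sqrt (scal_prod (w t) (w t))) has_integral l + sqrt 2 * norm p) {0..a + 1}"
  proof (rule has_integral_combine[of 0 a])
    have "((\<lambda>t. sqrt (scal_prod (u t) (u t))) has_integral l) {0..a}"
      using int l unfolding scal_length_def by (simp add: has_integral_integral)
    then show "((\<lambda>t. sqrt (scal_prod (w t) (w t))) has_integral l) {0..a}"
      by (rule has_integral_eq[rotated]) (simp add: w_def)
    have "((\<lambda>t. sqrt 2 * norm p) has_integral sqrt 2 * norm p) {a..a + 1}"
      using has_integral_const_real[of "sqrt 2 * norm p" a "a + 1"] by simp
    then show "((\<lambda>t. sqrt (scal_prod (w t) (w t))) has_integral sqrt 2 * norm p) {a..a + 1}"
      by (rule has_integral_spike_finite[of "{a}", rotated 2]) (auto simp: w_def sqrt_scal_prod_H0[OF p])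
  qed (use a in auto)
  show ?thesis
    unfolding reachable_def
    by (rule exI[of _ "a + 1"], rule exI[of _ f], rule exI[of _ w])
       (use C1 SL2 ctrl len a g0 in \<open>auto simp: f_def k_def hexp_def scal_length_def integral_unique has_integral_integrable\<close>)
qed

text \<open>The left-invariant form of reachability: from any endpoint already reached, right multiplication
  by \<open>q\<close> costs at most \<open>\<epsilon>\<close>. Being a property of \<open>q\<close> alone, it composes along products.\<close>

definition steers :: "real \<Rightarrow> cmat \<Rightarrow> bool"
  where "steers \<epsilon> q \<longleftrightarrow> (\<forall>l h. reachable l h \<longrightarrow> (\<exists>l'\<le>l + \<epsilon>. reachable l' (h ** q)))"

lemma rho_le_steers:
  assumes "steers \<epsilon> h"
  shows "rho (mat 1) h \<le> \<epsilon>"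
proof -
  obtain l where "l \<le> 0 + \<epsilon>" "reachable l (mat 1 ** h)"
    using assms reachable_mat_1 unfolding steers_def by blast
  then show ?thesis using rho_le_reachable[of l h] by simp
qed

lemma steers_mono: "steers \<delta> q \<Longrightarrow> \<delta> \<le> \<epsilon> \<Longrightarrow> steers \<epsilon> q"
  unfolding steers_def by (meson add_left_mono order_trans)

lemma steers_mat_1: "steers 0 (mat 1)"
  unfolding steers_def by auto

lemma steers_mult:
  assumes "steers \<delta> p" "steers \<epsilon> q"
  shows "steers (\<delta> + \<epsilon>) (p ** q)"
  unfolding steers_def
proof (intro allI impI)
  fix l h assume "reachable l h"
  with assms(1) obtain l1 where l1: "l1 \<le> l + \<delta>" "reachable l1 (h ** p)"
    unfolding steers_def by blast
  with assms(2) obtain l2 where "l2 \<le> l1 + \<epsilon>" "reachable l2 (h ** p ** q)"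
    unfolding steers_def by blast
  with l1 show "\<exists>l'\<le>l + (\<delta> + \<epsilon>). reachable l' (h ** (p ** q))"
    by (intro exI[of _ l2]) (auto simp: matrix_mul_assoc)
qed

lemma steers_hexp: "p \<in> H0 \<Longrightarrow> steers (sqrt 2 * norm p) (hexp p)"
  unfolding steers_def using reachable_hexp by blast

definition cmat_of :: "complex \<Rightarrow> complex \<Rightarrow> complex \<Rightarrow> complex \<Rightarrow> cmat"
  where "cmat_of a b c d = vector [vector [a, b], vector [c, d]]"

lemma cmat_of_entries [simp]:
  "cmat_of a b c d $ 1 $ 1 = a" "cmat_of a b c d $ 1 $ 2 = b"
  "cmat_of a b c d $ 2 $ 1 = c" "cmat_of a b c d $ 2 $ 2 = d"
  by (simp_all add: cmat_of_def)

text \<open>A positive definite Hermitian matrix of determinant 1 is \<open>hexp p\<close> for its logarithm \<open>p \<in> H0\<close>. Its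
  eigenvalues are \<open>exp r\<close> and \<open>exp (- r)\<close>, where the trace is \<open>2 cosh r\<close>, and the path with constant
  control \<open>p\<close> has length \<open>2 r\<close>; so the cost is controlled by the trace.\<close>

lemma steers_positive_hermitian:
  fixes a d :: real
  assumes "a > 0" and det: "a * d - (cmod b)\<^sup>2 = 1" and tr: "a + d \<le> 2 * cosh (\<epsilon> / 2)" and "\<epsilon> \<ge> 0"
  shows "steers \<epsilon> (cmat_of a b (cnj b) d)"
proof -
  have "a * d \<ge> 1" using det zero_le_power2[of "cmod b"] by linarith
  then have "d > 0" using \<open>a > 0\<close> by (metis less_le_trans zero_less_mult_pos zero_less_one)
  have "(a + d)\<^sup>2 \<ge> 2\<^sup>2"
    using \<open>a * d \<ge> 1\<close> zero_le_power2[of "a - d"] by (simp add: power2_eq_square algebra_simps)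
  then have tr2: "(a + d) / 2 \<ge> 1"
    using power2_le_imp_le[of 2 "a + d"] \<open>a > 0\<close> \<open>d > 0\<close> by simp
  define r where "r = arcosh ((a + d) / 2)"
  have r: "cosh r = (a + d) / 2" "r \<ge> 0"
    using tr2 by (simp_all add: r_def)
  have sinh_r: "(sinh r)\<^sup>2 = ((a - d) / 2)\<^sup>2 + (cmod b)\<^sup>2"
    using cosh_square_eq[of r] det unfolding r by (simp add: power2_eq_square field_simps)
  have r_le: "r \<le> \<epsilon> / 2"
  proof (rule ccontr)
    assume "\<not> r \<le> \<epsilon> / 2"
    then have "cosh (\<epsilon> / 2) < cosh r" using \<open>\<epsilon> \<ge> 0\<close> by (intro cosh_real_strict_mono) auto
    then show False using r tr by simp
  qed
  define p where "p = (r / sinh r) *\<^sub>R cmat_of ((a - d) / 2) b (cnj b) (- ((a - d) / 2))"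
  have p: "p \<in> H0"
    by (simp add: H0_iff p_def complex_eq_iff algebra_simps)
  have "(norm p)\<^sup>2 = (r / sinh r)\<^sup>2 * (2 * (sinh r)\<^sup>2)"
    unfolding sinh_r p_def norm_scaleR power_mult_distrib norm_cmat_power2
    by (simp add: norm_divide power_divide field_simps flip: of_real_diff)
  also have "\<dots> = 2 * r\<^sup>2"
    using r by (cases "r = 0") (simp_all add: power_divide)
  finally have norm_p: "norm p = sqrt 2 * r"
    using r by (metis real_sqrt_mult real_sqrt_abs abs_of_nonneg norm_ge_zero)
  have zero: "(a - d) / 2 = 0 \<and> b = 0" if "r = 0"
    using sinh_r that by (simp add: power2_eq_square add_nonneg_eq_0_iff)
  have "hexp p = cosh r *\<^sub>R mat 1 + (sinh r / r) *\<^sub>R p"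
    by (simp add: hexp_def hexp_line_def Let_def norm_p)
  also have "\<dots> = cmat_of a b (cnj b) d"
  proof (cases "r = 0")
    case True
    then show ?thesis using zero r by (simp add: cmat_eq_iff p_def complex_eq_iff)
  next
    case False
    then have "(sinh r / r) *\<^sub>R p = cmat_of ((a - d) / 2) b (cnj b) (- ((a - d) / 2))"
      by (simp add: p_def)
    then have "cosh r *\<^sub>R mat 1 + (sinh r / r) *\<^sub>R p
        = ((a + d) / 2) *\<^sub>R mat 1 + cmat_of ((a - d) / 2) b (cnj b) (- ((a - d) / 2))"
      by (simp only: r)
    then show ?thesis by (simp add: cmat_eq_iff complex_eq_iff field_simps)
  qed
  finally have "steers (sqrt 2 * norm p) (cmat_of a b (cnj b) d)"
    using steers_hexp[OF p] by simp
  then show ?thesis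
    by (rule steers_mono) (use r_le norm_p in \<open>simp add: mult.assoc[symmetric]\<close>)
qed

section \<open>Short horizontal paths to matrices near the unit\<close>

text \<open>A unipotent matrix with small entry \<open>z\<close> is the product of three positive definite matrices near the
  unit. If \<open>S\<close> is positive definite with off-diagonal entry of the phase of \<open>z\<close>, then the upper
  unipotent matrix times \<open>S\<close> has real eigenvalues, and a positive diagonal factor makes it
  Hermitian. An off-diagonal entry of modulus \<open>sqrt |z|\<close> keeps all three factors close to the unit.
  Transposition gives the lower unipotent matrices.\<close>

lemma steers_unipotent:
  assumes "\<epsilon> > 0"
  obtains \<delta> where "\<delta> > 0" "\<And>z. cmod z < \<delta> \<Longrightarrow> steers \<epsilon> (cmat_of 1 z 0 1)"
    "\<And>z. cmod z < \<delta> \<Longrightarrow> steers \<epsilon> (cmat_of 1 0 z 1)"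
proof -
  \<comment> \<open>The three factors share the cost \<open>\<epsilon>\<close>; \<open>C\<close> is the largest trace affordable for one of them.\<close>
  define C where "C = 2 * cosh (\<epsilon> / 3 / 2)"
  have C: "2 < C"
    using cosh_real_strict_mono[of 0 "\<epsilon> / 3 / 2"] assms by (simp add: C_def)
  define d where "d t = sqrt (1 + t\<^sup>2)" for t :: real
  define \<beta> where "\<beta> t = sqrt (1 + t * d t)" for t :: real
  have lim: "(d \<longlongrightarrow> 1) (nhds 0)" "(\<beta> \<longlongrightarrow> 1) (nhds 0)"
  proof -
    show d: "(d \<longlongrightarrow> 1) (nhds 0)"
      unfolding d_def by (rule tendsto_eq_intros refl filterlim_ident | simp)+
    show "(\<beta> \<longlongrightarrow> 1) (nhds 0)"
      unfolding \<beta>_def by (rule tendsto_eq_intros refl filterlim_ident d | simp)+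
  qed
  have "\<forall>\<^sub>F t in nhds 0. d t + d t < C"
    by (rule order_tendstoD(2)[OF _ C]) (rule tendsto_eq_intros lim refl | simp)+
  moreover have "\<forall>\<^sub>F t in nhds 0. \<beta> t + 1 / \<beta> t < C"
    by (rule order_tendstoD(2)[OF _ C]) (rule tendsto_eq_intros lim refl | simp)+
  moreover have "\<forall>\<^sub>F t in nhds 0. (d t + t ^ 3) / \<beta> t + d t * \<beta> t < C"
    by (rule order_tendstoD(2)[OF _ C]) (rule tendsto_eq_intros lim filterlim_ident refl | simp)+
  ultimately have "\<forall>\<^sub>F t in nhds 0. d t + d t < C \<and> \<beta> t + 1 / \<beta> t < C \<and>
      (d t + t ^ 3) / \<beta> t + d t * \<beta> t < C"
    by eventually_elim simp
  then obtain \<delta> where "\<delta> > 0" and small: "\<And>t. \<bar>t\<bar> < \<delta> \<Longrightarrow>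
      d t + d t < C \<and> \<beta> t + 1 / \<beta> t < C \<and> (d t + t ^ 3) / \<beta> t + d t * \<beta> t < C"
    unfolding eventually_nhds_metric dist_real_def by auto
  have "steers \<epsilon> (cmat_of 1 z 0 1) \<and> steers \<epsilon> (cmat_of 1 0 z 1)" if z: "cmod z < \<delta>\<^sup>2" for z
  proof (cases "z = 0")
    case True
    have "cmat_of 1 0 0 1 = mat 1" by (simp add: cmat_eq_iff)
    then show ?thesis using True steers_mono[OF steers_mat_1, of \<epsilon>] assms by simp
  next
    case False
    define t where "t = sqrt (cmod z)"
    define \<phi> where "\<phi> = sgn z"
    have t: "t > 0" "t\<^sup>2 = cmod z" "\<bar>t\<bar> < \<delta>"
      using False z \<open>\<delta> > 0\<close> by (auto simp: t_def intro: real_sqrt_less_mono real_less_lsqrt)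
    have \<phi>: "z = \<phi> * of_real (t\<^sup>2)" "\<phi> * cnj \<phi> = 1" "cmod \<phi> = 1"
    proof -
      show "z = \<phi> * of_real (t\<^sup>2)"
        using False unfolding t(2) by (simp add: \<phi>_def sgn_eq)
      show "cmod \<phi> = 1" using False by (simp add: \<phi>_def norm_sgn)
      then show "\<phi> * cnj \<phi> = 1" by (simp add: complex_norm_square[symmetric])
    qed
    define D where "D = d t"
    define B where "B = \<beta> t"
    have D: "D\<^sup>2 = 1 + t\<^sup>2" "D > 0"
      by (simp_all add: D_def d_def add_pos_nonneg)
    have B: "B\<^sup>2 = 1 + t * D" "B > 0"
      using t D(2) by (simp_all add: B_def \<beta>_def D_def[symmetric] add_pos_nonneg)
    note sm = small[OF t(3), folded D_def B_def]
    note pos = steers_positive_hermitian[where \<epsilon> = "\<epsilon> / 3", folded C_def]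
    define S where "S w = cmat_of D (- (w * of_real t)) (cnj (- (w * of_real t))) D" for w
    define S1 where "S1 = cmat_of (of_real B) 0 (cnj 0) (of_real (1 / B))"
    define S2 where "S2 w = cmat_of (of_real ((D + t ^ 3) / B)) (w * of_real (t * B))
      (cnj (w * of_real (t * B))) (of_real (D * B))" for w
    have st: "steers (\<epsilon> / 3) (S w)" "steers (\<epsilon> / 3) S1" "steers (\<epsilon> / 3) (S2 w)" if w: "cmod w = 1" for w
    proof -
      show "steers (\<epsilon> / 3) (S w)"
        unfolding S_def by (rule pos) (use sm D t w assms in \<open>simp_all add: norm_mult power2_eq_square\<close>)
      show "steers (\<epsilon> / 3) S1"
        unfolding S1_def by (rule pos) (use sm B assms in simp_all)
      have "(D + t ^ 3) / B * (D * B) - (t * B)\<^sup>2 = (D + t ^ 3) * D - t\<^sup>2 * (1 + t * D)"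
        using B by (simp add: power_mult_distrib)
      also have "\<dots> = 1"
        using D by (simp add: algebra_simps power2_eq_square power3_eq_cube)
      finally have "(D + t ^ 3) / B * (D * B) - (t * B)\<^sup>2 = 1" .
      moreover have "(D + t ^ 3) / B > 0" using D(2) B(2) t(1) by (simp add: add_pos_pos)
      ultimately show "steers (\<epsilon> / 3) (S2 w)"
        unfolding S2_def by (intro pos) (use sm B D t w assms in \<open>simp_all add: norm_mult\<close>)
    qed
    have D': "complex_of_real D * of_real D = 1 + of_real t * of_real t"
      using D(1) by (metis of_real_1 of_real_add of_real_mult power2_eq_square)
    have B': "complex_of_real B * of_real B = 1 + of_real t * of_real D"
      using B(1) by (metis of_real_1 of_real_add of_real_mult power2_eq_square)
    have nz: "complex_of_real B \<noteq> 0" using B by simp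
    \<comment> \<open>Here \<open>S \<phi>\<close> is the inverse of the positive definite matrix with diagonal \<open>D\<close> and off-diagonal
      entry \<open>\<phi> t\<close>. The second product is the transpose of the first.\<close>
    have prod: "S1 ** S2 \<phi> ** S \<phi> = cmat_of 1 z 0 1" "S (cnj \<phi>) ** S2 (cnj \<phi>) ** S1 = cmat_of 1 0 z 1"
    proof -
      have up: "cmat_of (D + t ^ 3) (w * t * (1 + t * D)) (v * t) D ** cmat_of D (- (w * t)) (- (v * t)) D
          = cmat_of 1 (w * t\<^sup>2) 0 1"
        if "w * v = 1" "D * D = 1 + t * t" for D t v w :: complex
        unfolding cmat_eq_iff matrix_mult_entries cmat_of_entries
        by (intro conjI) (use that in \<open>algebra | simp\<close>)+
      have low: "cmat_of D (- (v * t)) (- (w * t)) D ** cmat_of (D + t ^ 3) (v * t) (w * t * (1 + t * D)) D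
          = cmat_of 1 0 (w * t\<^sup>2) 1"
        if "w * v = 1" "D * D = 1 + t * t" for D t v w :: complex
        unfolding cmat_eq_iff matrix_mult_entries cmat_of_entries
        by (intro conjI) (use that in \<open>algebra | simp\<close>)+
      have "S1 ** S2 \<phi> = cmat_of (of_real D + of_real t ^ 3)
          (\<phi> * of_real t * (1 + of_real t * of_real D)) (cnj \<phi> * of_real t) (of_real D)"
        using nz by (simp add: S1_def S2_def cmat_eq_iff matrix_mult_entries B'[symmetric])
      then show "S1 ** S2 \<phi> ** S \<phi> = cmat_of 1 z 0 1"
        using up[OF \<phi>(2) D'] by (simp add: S_def \<phi>(1))
      have "S2 (cnj \<phi>) ** S1 = cmat_of (of_real D + of_real t ^ 3) (cnj \<phi> * of_real t)
          (\<phi> * of_real t * (1 + of_real t * of_real D)) (of_real D)"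
        using nz by (simp add: S1_def S2_def cmat_eq_iff matrix_mult_entries B'[symmetric])
      then show "S (cnj \<phi>) ** S2 (cnj \<phi>) ** S1 = cmat_of 1 0 z 1"
        using low[OF \<phi>(2) D'] by (simp add: S_def \<phi>(1) matrix_mul_assoc[symmetric])
    qed
    have "steers (\<epsilon> / 3 + \<epsilon> / 3 + \<epsilon> / 3) (cmat_of 1 z 0 1)"
      unfolding prod(1)[symmetric] by (intro steers_mult st(1) st(2)[of \<phi>] st(3)) (simp_all add: \<phi>)
    moreover have "steers (\<epsilon> / 3 + \<epsilon> / 3 + \<epsilon> / 3) (cmat_of 1 0 z 1)"
      unfolding prod(2)[symmetric] by (intro steers_mult st(1) st(2)[of \<phi>] st(3)) (simp_all add: \<phi>)
    ultimately show ?thesis by simp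
  qed
  then show ?thesis using \<open>\<delta> > 0\<close> by (intro that[of "\<delta>\<^sup>2"]) auto
qed

text \<open>A matrix of determinant 1 whose lower right entry is 1 is an upper times a lower unipotent matrix. A
  general \<open>q\<close> near the unit is brought to this form by two column operations: the first, by a
  fixed small \<open>s\<close>, makes the lower left entry about \<open>s\<close>; since this is not 0, the second, by a small
  multiple of the first column, then corrects the lower right entry to 1.\<close>

lemma steers_near_mat_1:
  assumes "\<epsilon> > 0"
  obtains \<delta> where "\<delta> > 0" "\<And>q. q \<in> SL2 \<Longrightarrow> norm (q - mat 1) < \<delta> \<Longrightarrow> steers \<epsilon> q"
proof -
  obtain \<eta> where "\<eta> > 0" and up: "\<And>z. cmod z < \<eta> \<Longrightarrow> steers (\<epsilon> / 4) (cmat_of 1 z 0 1)"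
    and low: "\<And>z. cmod z < \<eta> \<Longrightarrow> steers (\<epsilon> / 4) (cmat_of 1 0 z 1)"
    using steers_unipotent[of "\<epsilon> / 4"] assms by auto
  define s where "s = complex_of_real (\<eta> / 2)"
  have s: "cmod s < \<eta>" "s \<noteq> 0" using \<open>\<eta> > 0\<close> by (simp_all add: s_def)
  define y where "y q = q$2$1 + s * q$2$2" for q :: cmat
  define z where "z q = (1 - q$2$2) / y q" for q :: cmat
  define x where "x q = q$1$2 + z q * (q$1$1 + s * q$1$2)" for q :: cmat
  have nth: "((\<lambda>q :: cmat. q $ i $ j) \<longlongrightarrow> mat 1 $ i $ j) (nhds (mat 1))" for i j
    by (intro tendsto_vec_nth filterlim_ident)
  have y: "(y \<longlongrightarrow> s) (nhds (mat 1))"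
    unfolding y_def by (rule tendsto_eq_intros nth refl | simp)+
  have z: "(z \<longlongrightarrow> 0) (nhds (mat 1))"
    unfolding z_def by (rule tendsto_eq_intros nth y refl | simp add: s)+
  have x: "(x \<longlongrightarrow> 0) (nhds (mat 1))"
    unfolding x_def by (rule tendsto_eq_intros nth z refl | simp)+
  have "\<forall>\<^sub>F q in nhds (mat 1). cmod (y q) < \<eta>"
    by (rule order_tendstoD(2)[OF tendsto_norm[OF y] s(1)])
  moreover have "\<forall>\<^sub>F q in nhds (mat 1). cmod (z q) < \<eta>"
    by (rule order_tendstoD(2)[OF tendsto_norm[OF z]]) (simp add: \<open>\<eta> > 0\<close>)
  moreover have "\<forall>\<^sub>F q in nhds (mat 1). cmod (x q) < \<eta>"
    by (rule order_tendstoD(2)[OF tendsto_norm[OF x]]) (simp add: \<open>\<eta> > 0\<close>)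
  moreover have "\<forall>\<^sub>F q in nhds (mat 1). y q \<noteq> 0"
    by (rule tendsto_imp_eventually_ne[OF y s(2)])
  ultimately have "\<forall>\<^sub>F q in nhds (mat 1). cmod (y q) < \<eta> \<and> cmod (z q) < \<eta> \<and> cmod (x q) < \<eta> \<and> y q \<noteq> 0"
    by eventually_elim simp
  then obtain \<delta> where "\<delta> > 0" and \<delta>: "\<And>q. norm (q - mat 1) < \<delta> \<Longrightarrow>
      cmod (y q) < \<eta> \<and> cmod (z q) < \<eta> \<and> cmod (x q) < \<eta> \<and> y q \<noteq> 0"
    unfolding eventually_nhds_metric dist_norm by auto
  show ?thesis
  proof (rule that[OF \<open>\<delta> > 0\<close>])
    fix q assume q: "q \<in> SL2" "norm (q - mat 1) < \<delta>"
    note b = \<delta>[OF q(2)]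
    have det: "q$1$1 * q$2$2 - q$1$2 * q$2$1 = 1" using q by (simp add: SL2_def det_2)
    have zy: "z q * y q = 1 - q$2$2" using b by (simp add: z_def)
    have "q = cmat_of 1 (x q) 0 1 ** cmat_of 1 0 (y q) 1 ** cmat_of 1 (- z q) 0 1 ** cmat_of 1 0 (- s) 1"
    proof -
      \<comment> \<open>The upper left entry after the column operations, computed from the determinant.\<close>
      have "1 + x q * y q = q$1$1 + s * q$1$2"
        using det zy unfolding x_def y_def by algebra
      then show ?thesis
        using zy unfolding cmat_eq_iff matrix_mult_entries x_def y_def
        by simp algebra
    qed
    moreover have "steers (\<epsilon> / 4 + \<epsilon> / 4 + \<epsilon> / 4 + \<epsilon> / 4) \<dots>"
      by (intro steers_mult up low) (use b s in auto)
    ultimately show "steers \<epsilon> q" by simp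
  qed
qed

section \<open>Lipschitz horizontal curves compared with the distance\<close>

lemma integral_in_H0:
  assumes "w integrable_on S" "\<And>t. w t \<in> H0"
  shows "integral S w \<in> H0"
proof -
  define T :: "cmat \<Rightarrow> cmat" where "T h = cmat_of (of_real (Im (h$1$1))) (h$2$2 + h$1$1) (h$2$1 - cnj (h$1$2)) 0" for h
  have T: "T h = 0 \<longleftrightarrow> h \<in> H0" for h
    unfolding T_def H0_iff by (auto simp: cmat_eq_iff add_eq_0_iff2)
  have "bounded_linear T"
    unfolding linear_conv_bounded_linear[symmetric]
    by (rule linearI) (simp_all add: T_def cmat_eq_iff complex_eq_iff algebra_simps)
  then have "T (integral S w) = integral S (T \<circ> w)"
    using integral_linear[OF assms(1)] by metis
  also have "T \<circ> w = (\<lambda>t. 0)" using T assms(2) by (auto simp: o_def)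
  finally show ?thesis using T by simp
qed

lemma lipschitz_on_interval_bounded:
  fixes g :: "real \<Rightarrow> cmat"
  assumes "L-lipschitz_on {a..b} g"
  obtains M where "M > 0" "\<And>t. t \<in> {a..b} \<Longrightarrow> norm (g t) \<le> M"
proof -
  have "bounded (g ` {a..b})"
    using lipschitz_on_continuous_on[OF assms] by (intro compact_imp_bounded compact_continuous_image) auto
  then obtain M where "M > 0" "\<forall>x\<in>g ` {a..b}. norm x \<le> M" unfolding bounded_pos by blast
  then show ?thesis by (intro that[of M]) auto
qed

text \<open>The control may be altered on a null set so that it lies in \<open>H0\<close> and is bounded everywhere. It is
  integrable because it is the product of the continuous inverse of \<open>g\<close> and the derivative of \<open>g\<close>.\<close>

lemma SL2_curve_integral_form:
  assumes hc: "horizontal_curve SL2 H0 a b g v"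
  obtains w K where "K > 0" "\<And>t. w t \<in> H0" "\<And>t. norm (w t) \<le> K"
    "w absolutely_integrable_on {a..b}"
    "AE t in lebesgue. t \<in> {a..b} \<longrightarrow> v t = w t"
    "\<And>s t. a \<le> s \<Longrightarrow> s \<le> t \<Longrightarrow> t \<le> b \<Longrightarrow> ((\<lambda>r. g r ** w r) has_integral g t - g s) {s..t}"
proof -
  have "a < b" and ex: "\<exists>L. L-lipschitz_on {a..b} g" and SL2: "g ` {a..b} \<subseteq> SL2"
    and ctrl: "AE t in lebesgue. t \<in> {a..b} \<longrightarrow> v t \<in> H0 \<and> (g has_vector_derivative (g t ** v t)) (at t within {a..b})"
    using hc unfolding horizontal_curve_def left_control_def by (simp_all only: simp_thms)
  obtain L where lip: "L-lipschitz_on {a..b} g" using ex ..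
  obtain M where M: "M > 0" "\<And>t. t \<in> {a..b} \<Longrightarrow> norm (g t) \<le> M"
    by (rule lipschitz_on_interval_bounded[OF lip]) (rule that; assumption)
  have L0: "L \<ge> 0" using lip by (rule lipschitz_on_nonneg)
  have bound: "AE t in lebesgue. t \<in> {a..b} \<longrightarrow> norm (g t ** v t) \<le> L"
    by (rule lipschitz_fundamental_theorem(2)[OF _ lip]) (use \<open>a < b\<close> ctrl in auto)
  define good where "good t \<longleftrightarrow> t \<in> {a..b} \<and> v t \<in> H0 \<and>
    (g has_vector_derivative (g t ** v t)) (at t within {a..b}) \<and> norm (g t ** v t) \<le> L" for t
  have good: "AE t in lebesgue. t \<in> {a..b} \<longrightarrow> good t"
    using ctrl bound by eventually_elim (auto simp: good_def)
  define w where "w t = (if good t then v t else 0)" for t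
  have w_adj: "w t = adjugate (g t) ** (g t ** w t)" if "t \<in> {a..b}" for t
    using adjugate_SL2(2)[of "g t"] SL2 that by (simp add: matrix_mul_assoc image_subset_iff)
  have w_le: "norm (w t) \<le> M * L" for t
  proof (cases "good t")
    case True
    then have t: "t \<in> {a..b}" "norm (g t ** w t) \<le> L" by (auto simp: good_def w_def)
    have "norm (w t) \<le> norm (adjugate (g t)) * norm (g t ** w t)"
      by (subst w_adj[OF t(1)]) (rule norm_matrix_mult_le)
    also have "\<dots> \<le> M * L" by (intro mult_mono) (use M t in auto)
    finally show ?thesis .
  qed (use M L0 in \<open>simp add: w_def\<close>)
  have deriv: "AE t in lebesgue. t \<in> {s..r} \<longrightarrow> (g has_vector_derivative g t ** w t) (at t within {s..r})"
    if "a \<le> s" "r \<le> b" for s r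
    using good
  proof eventually_elim
    case (elim t)
    show ?case
    proof
      assume t: "t \<in> {s..r}"
      then have "good t" using elim that by auto
      then have "(g has_vector_derivative g t ** w t) (at t within {a..b})"
        by (simp add: good_def w_def)
      then show "(g has_vector_derivative g t ** w t) (at t within {s..r})"
        by (rule has_vector_derivative_within_subset) (use that in auto)
    qed
  qed
  have int: "((\<lambda>r. g r ** w r) has_integral g t - g s) {s..t}" if "a \<le> s" "s \<le> t" "t \<le> b" for s t
    by (rule lipschitz_fundamental_theorem(1)[OF _ lipschitz_on_subset[OF lip] deriv]) (use that in auto)
  have gw_bound: "norm (g t ** w t) \<le> L" for t
    using L0 by (auto simp: w_def good_def)
  have gw: "(\<lambda>t. g t ** w t) absolutely_integrable_on {a..b}"
    by (rule absolutely_integrable_integrable_bound[where g = "\<lambda>_. L"])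
       (use int[of a b] \<open>a < b\<close> gw_bound in auto)
  have meas: "(\<lambda>t. adjugate (g t)) \<in> borel_measurable (lebesgue_on {a..b})"
  proof (rule continuous_imp_measurable_on_sets_lebesgue)
    have "linear adjugate"
      by (rule linearI) (simp_all add: cmat_eq_iff)
    then show "continuous_on {a..b} (\<lambda>t. adjugate (g t))"
      by (intro linear_continuous_on_compose[OF lipschitz_on_continuous_on[OF lip]])
  qed simp
  have bdd: "bounded ((\<lambda>t. adjugate (g t)) ` {a..b})"
    by (rule boundedI[of _ M]) (use M in auto)
  have bil: "bilinear ((**) :: cmat \<Rightarrow> cmat \<Rightarrow> cmat)"
    unfolding bilinear_conv_bounded_bilinear by (rule bounded_bilinear_matrix_mult)
  have "(\<lambda>t. adjugate (g t) ** (g t ** w t)) absolutely_integrable_on {a..b}"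
    by (rule absolutely_integrable_bounded_measurable_product[OF bil meas _ bdd gw]) simp
  then have "w absolutely_integrable_on {a..b}"
    by (rule absolutely_integrable_spike[of _ _ "{}"]) (use w_adj in blast)+
  moreover have "w t \<in> H0" for t
    by (auto simp: w_def good_def subspace_0[OF subspace_H0])
  moreover have "AE t in lebesgue. t \<in> {a..b} \<longrightarrow> v t = w t"
    using good by eventually_elim (auto simp: w_def)
  ultimately show ?thesis
  proof (intro that[of "M * L + 1" w])
    show "M * L + 1 > 0" using M L0 by (simp add: add_nonneg_pos)
    show "norm (w t) \<le> M * L + 1" for t using w_le[of t] by simp
  qed (use int in auto)
qed

lemma scal_length_eq:
  fixes w :: "real \<Rightarrow> cmat"
  assumes "\<And>t. w t \<in> H0" "AE t in lebesgue. t \<in> {a..b} \<longrightarrow> v t = w t"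
    and "w absolutely_integrable_on {a..b}" "{s..t} \<subseteq> {a..b}"
  shows "((\<lambda>r. sqrt (scal_prod (v r) (v r))) has_integral sqrt 2 * integral {s..t} (\<lambda>r. norm (w r))) {s..t}"
proof (rule has_integral_spike)
  show "negligible {t. \<not> (t \<in> {a..b} \<longrightarrow> v t = w t)}"
    using assms(2) unfolding AE_lebesgue_negligible .
  have "(\<lambda>r. norm (w r)) integrable_on {s..t}"
    using absolutely_integrable_on_subinterval[OF assms(3,4)]
    by (auto simp: absolutely_integrable_on_def)
  then show "((\<lambda>r. sqrt 2 * norm (w r)) has_integral sqrt 2 * integral {s..t} (\<lambda>r. norm (w r))) {s..t}"
    by (intro has_integral_mult_right) (simp add: has_integral_integral)
  show "sqrt (scal_prod (v r) (v r)) = sqrt 2 * norm (w r)"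
    if "r \<in> {s..t} - {t. \<not> (t \<in> {a..b} \<longrightarrow> v t = w t)}" for r
    using that assms(1,4) by (auto simp: sqrt_scal_prod_H0)
qed

text \<open>Relative to the starting point \<open>g s\<close>, both the curve and the exponential \<open>hexp W\<close>, which is the
  effect of the averaged control, differ from \<open>mat 1 + W\<close> only by terms quadratic in \<open>t - s\<close>.\<close>

lemma one_step_estimate:
  fixes g w :: "real \<Rightarrow> cmat"
  assumes lip: "L-lipschitz_on {a..b} g" and M: "\<And>t. t \<in> {a..b} \<Longrightarrow> norm (g t) \<le> M"
    and w: "\<And>t. w t \<in> H0" "\<And>t. norm (w t) \<le> K" "w absolutely_integrable_on {a..b}"
    and st: "a \<le> s" "s \<le> t" "t \<le> b" and small: "K * (t - s) \<le> 1"
    and int: "((\<lambda>r. g r ** w r) has_integral g t - g s) {s..t}"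
  defines "W \<equiv> integral {s..t} w"
  shows "W \<in> H0" "norm W \<le> integral {s..t} (\<lambda>r. norm (w r))" "norm (hexp W - mat 1) \<le> 3 * K * (t - s)"
    "norm (g t - g s ** hexp W) \<le> (L * K + 2 * M * K\<^sup>2) * (t - s)\<^sup>2"
proof -
  have K0: "K \<ge> 0" using w(2) norm_ge_zero order_trans by blast
  have L0: "L \<ge> 0" using lip by (rule lipschitz_on_nonneg)
  have M0: "M \<ge> 0" using M[of s] st norm_ge_zero order_trans by (metis atLeastAtMost_iff)
  have "w absolutely_integrable_on {s..t}"
    by (rule absolutely_integrable_on_subinterval[OF w(3)]) (use st in auto)
  then have wint: "w integrable_on {s..t}" "(\<lambda>r. norm (w r)) integrable_on {s..t}"
    by (auto simp: absolutely_integrable_on_def)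
  show "W \<in> H0" unfolding W_def by (rule integral_in_H0[OF wint(1) w(1)])
  show "norm W \<le> integral {s..t} (\<lambda>r. norm (w r))"
    unfolding W_def by (rule Henstock_Kurzweil_Integration.integral_norm_bound_integral[OF wint]) auto
  have W_has: "(w has_integral W) {s..t}"
    unfolding W_def using wint(1) by (rule integrable_integral)
  have W: "norm W \<le> K * (t - s)"
    using has_integral_bound[OF K0 W_has[unfolded cbox_interval[symmetric]]] w(2) st by simp
  have e1: "norm (hexp W - mat 1 - W) \<le> 2 * (norm W)\<^sup>2"
    by (rule norm_hexp_minus_le) (use W small in linarith)
  also have "\<dots> \<le> 2 * (K * (t - s))\<^sup>2"
    by (intro mult_left_mono power_mono W) auto
  finally have e2: "norm (hexp W - mat 1 - W) \<le> 2 * (K * (t - s))\<^sup>2" .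
  have "(K * (t - s))\<^sup>2 \<le> 1 * (K * (t - s))"
    unfolding power2_eq_square by (intro mult_right_mono small) (use K0 st in auto)
  moreover have "norm (hexp W - mat 1) \<le> norm (hexp W - mat 1 - W) + norm W"
    using norm_triangle_ineq[of "hexp W - mat 1 - W" W] by simp
  ultimately show "norm (hexp W - mat 1) \<le> 3 * K * (t - s)"
    using e2 W by linarith
  have "((\<lambda>r. g r ** w r - g s ** w r) has_integral (g t - g s) - g s ** W) {s..t}"
    using has_integral_linear[OF W_has matrix_mult.bounded_linear_right[of "g s"]]
    by (intro has_integral_diff int) (simp add: o_def)
  moreover have "norm (g r ** w r - g s ** w r) \<le> L * (t - s) * K" if r: "r \<in> {s..t}" for r
  proof -
    have "norm (g r ** w r - g s ** w r) \<le> norm (g r - g s) * norm (w r)"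
      unfolding matrix_mult.diff_left[symmetric] by (rule norm_matrix_mult_le)
    also have "\<dots> \<le> L * (t - s) * K"
    proof (rule mult_mono[OF _ w(2)])
      have "norm (g r - g s) \<le> L * norm (r - s)"
        by (rule lipschitz_on_normD[OF lip]) (use r st in auto)
      also have "\<dots> \<le> L * (t - s)"
        by (intro mult_left_mono L0) (use r in auto)
      finally show "norm (g r - g s) \<le> L * (t - s)" .
    qed (use L0 st in auto)
    finally show ?thesis .
  qed
  ultimately have "norm ((g t - g s) - g s ** W) \<le> L * (t - s) * K * measure lborel (cbox s t)"
    by (intro has_integral_bound) (use K0 L0 st in auto)
  then have e3: "norm ((g t - g s) - g s ** W) \<le> L * K * (t - s)\<^sup>2"
    using st by (simp add: power2_eq_square mult_ac)
  have "norm (g s ** (hexp W - mat 1 - W)) \<le> norm (g s) * norm (hexp W - mat 1 - W)"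
    by (rule norm_matrix_mult_le)
  also have "\<dots> \<le> M * (2 * (K * (t - s))\<^sup>2)"
    by (intro mult_mono M e2) (use st M0 in auto)
  finally have e4: "norm (g s ** (hexp W - mat 1 - W)) \<le> 2 * M * K\<^sup>2 * (t - s)\<^sup>2"
    by (simp add: power_mult_distrib mult_ac)
  have eq: "g t - g s ** hexp W = ((g t - g s) - g s ** W) - g s ** (hexp W - mat 1 - W)"
    by (simp add: matrix_mult.diff_right)
  have "norm (g t - g s ** hexp W) \<le> L * K * (t - s)\<^sup>2 + 2 * M * K\<^sup>2 * (t - s)\<^sup>2"
    unfolding eq by (rule order_trans[OF norm_triangle_ineq4 add_mono[OF e3 e4]])
  then show "norm (g t - g s ** hexp W) \<le> (L * K + 2 * M * K\<^sup>2) * (t - s)\<^sup>2"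
    by (simp add: distrib_right)
qed

text \<open>The \<open>n\<close> local errors of order \<open>h\<^sup>2\<close>, where \<open>h = (b - a) / n\<close>, are amplified at most by a factor
  bounded independently of \<open>n\<close> (discrete Gronwall), so the endpoint is missed by order \<open>1 / n\<close>.\<close>

lemma steers_approximation:
  assumes hc: "horizontal_curve SL2 H0 a b g v" and "g a = mat 1" and "\<epsilon> > 0"
  obtains Q where "Q \<in> SL2" "steers (scal_length a b v) Q" "norm (Q - g b) < \<epsilon>"
proof -
  have "a < b" and ex: "\<exists>L. L-lipschitz_on {a..b} g"
    using hc unfolding horizontal_curve_def by (simp_all only: simp_thms)
  obtain L where lip: "L-lipschitz_on {a..b} g" using ex ..
  obtain w K where K: "K > 0" and w: "\<And>t. w t \<in> H0" "\<And>t. norm (w t) \<le> K" "w absolutely_integrable_on {a..b}"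
    and vw: "AE t in lebesgue. t \<in> {a..b} \<longrightarrow> v t = w t"
    and int: "\<And>s t. a \<le> s \<Longrightarrow> s \<le> t \<Longrightarrow> t \<le> b \<Longrightarrow> ((\<lambda>r. g r ** w r) has_integral g t - g s) {s..t}"
    by (rule SL2_curve_integral_form[OF hc]) (rule that; assumption)
  obtain M where M: "M > 0" "\<And>t. t \<in> {a..b} \<Longrightarrow> norm (g t) \<le> M"
    by (rule lipschitz_on_interval_bounded[OF lip]) (rule that; assumption)
  have L0: "L \<ge> 0" using lip by (rule lipschitz_on_nonneg)
  define B where "B = L * K + 2 * M * K\<^sup>2"
  have B: "B > 0" using K M L0 by (simp add: B_def add_nonneg_pos)
  define S where "S t = sqrt 2 * integral {a..t} (\<lambda>r. norm (w r))" for t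
  define X where "X = (b - a) * B * (b - a) * exp (3 * K * (b - a))"
  have X: "X > 0" using \<open>a < b\<close> B by (simp add: X_def)
  \<comment> \<open>The first bound on \<open>n\<close> yields \<open>K h \<le> 1\<close>, as the estimate of one step requires; the second makes
    the total error, at most \<open>X / n\<close>, smaller than \<open>\<epsilon>\<close>.\<close>
  obtain n :: nat where n: "real n > max (K * (b - a)) (X / \<epsilon>)"
    using reals_Archimedean2 by blast
  then have n0: "n > 0" "K * (b - a) < real n" "X / \<epsilon> < real n"
    using K \<open>a < b\<close> by (auto intro!: Nat.gr0I simp: mult_less_0_iff not_less[symmetric])
  define h where "h = (b - a) / real n"
  have h: "h > 0" "real n * h = b - a" "K * h \<le> 1"
    using n0 \<open>a < b\<close> by (auto simp: h_def field_simps)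
  define q where "q = 1 + 3 * K * h"
  have q: "q \<ge> 1" using K h by (simp add: q_def)
  have "\<exists>Q. Q \<in> SL2 \<and> steers (S (a + real i * h)) Q \<and> norm (Q - g (a + real i * h)) \<le> real i * (B * h\<^sup>2) * q ^ i"
    if "i \<le> n" for i
    using that
  proof (induction i)
    case 0
    show ?case using \<open>g a = mat 1\<close> steers_mat_1 by (intro exI[of _ "mat 1"]) (simp add: S_def)
  next
    case (Suc i)
    define s where "s = a + real i * h"
    define t where "t = a + real (Suc i) * h"
    have "real (Suc i) * h \<le> real n * h" using Suc.prems h by (intro mult_right_mono) auto
    then have st: "a \<le> s" "s \<le> t" "t \<le> b" "t - s = h"
      using h by (auto simp: s_def t_def algebra_simps)
    obtain Q where Q: "Q \<in> SL2" "steers (S s) Q" "norm (Q - g s) \<le> real i * (B * h\<^sup>2) * q ^ i"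
      using Suc unfolding s_def by auto
    define W where "W = integral {s..t} w"
    note step = one_step_estimate[OF lip M(2) w st(1-3) _ int[OF st(1-3)], folded W_def, unfolded st(4), OF _ h(3), folded B_def]
    have "Q ** hexp W \<in> SL2"
      using Q(1) hexp_line_SL2[OF step(1)] unfolding hexp_def by (intro SL2_mult)
    moreover have "steers (S t) (Q ** hexp W)"
    proof (rule steers_mono[OF steers_mult[OF Q(2) steers_hexp[OF step(1)]]])
      have "(\<lambda>r. norm (w r)) integrable_on {a..b}"
        using w(3) by (auto simp: absolutely_integrable_on_def)
      then have "(\<lambda>r. norm (w r)) integrable_on {a..t}"
        by (rule integrable_subinterval_real) (use st in auto)
      then have "integral {a..s} (\<lambda>r. norm (w r)) + integral {s..t} (\<lambda>r. norm (w r)) = integral {a..t} (\<lambda>r. norm (w r))"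
        by (intro Henstock_Kurzweil_Integration.integral_combine st)
      then show "S s + sqrt 2 * norm W \<le> S t"
        using step(2) unfolding S_def by (metis distrib_left add_left_mono mult_left_mono real_sqrt_ge_zero zero_le_numeral)
    qed
    moreover have "norm (Q ** hexp W - g t) \<le> real (Suc i) * (B * h\<^sup>2) * q ^ Suc i"
    proof -
      have "Q ** hexp W - g t = (Q - g s) + (Q - g s) ** (hexp W - mat 1) - (g t - g s ** hexp W)"
        by (simp add: matrix_mult.diff_right matrix_mult.diff_left)
      then have "norm (Q ** hexp W - g t)
          \<le> norm ((Q - g s) + (Q - g s) ** (hexp W - mat 1)) + norm (g t - g s ** hexp W)"
        by (simp only: norm_triangle_ineq4)
      moreover have "norm ((Q - g s) + (Q - g s) ** (hexp W - mat 1)) \<le> real i * (B * h\<^sup>2) * q ^ i * q"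
      proof -
        have "norm ((Q - g s) + (Q - g s) ** (hexp W - mat 1))
            \<le> norm (Q - g s) + norm (Q - g s) * norm (hexp W - mat 1)"
          by (rule norm_triangle_le) (use norm_matrix_mult_le in simp)
        also have "\<dots> \<le> norm (Q - g s) + norm (Q - g s) * (3 * K * h)"
          by (intro add_left_mono mult_left_mono step) auto
        also have "\<dots> = norm (Q - g s) * q"
          by (simp add: q_def algebra_simps)
        also have "\<dots> \<le> real i * (B * h\<^sup>2) * q ^ i * q"
          by (intro mult_right_mono Q) (use q in auto)
        finally show ?thesis .
      qed
      moreover have "norm (g t - g s ** hexp W) \<le> B * h\<^sup>2 * q ^ Suc i"
      proof -
        have "B * h\<^sup>2 * 1 \<le> B * h\<^sup>2 * q ^ Suc i"
          using q B by (intro mult_left_mono one_le_power) auto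
        then show ?thesis using step(4) by simp
      qed
      ultimately have "norm (Q ** hexp W - g t)
          \<le> real i * (B * h\<^sup>2) * q ^ i * q + B * h\<^sup>2 * q ^ Suc i"
        by linarith
      then show ?thesis by (simp add: algebra_simps)
    qed
    ultimately show ?case unfolding t_def[symmetric] by blast
  qed
  from this[of n] obtain Q where Q: "Q \<in> SL2" "steers (S b) Q" "norm (Q - g b) \<le> real n * (B * h\<^sup>2) * q ^ n"
    using h by auto
  have "q ^ n \<le> exp (3 * K * h) ^ n"
    unfolding q_def using K h by (intro power_mono exp_ge_add_one_self) auto
  also have "\<dots> = exp (3 * K * (b - a))"
    unfolding exp_of_nat_mult[symmetric] h(2)[symmetric] by (simp add: mult_ac)
  finally have "real n * (B * h\<^sup>2) * q ^ n \<le> real n * (B * h\<^sup>2) * exp (3 * K * (b - a))"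
    using B by (intro mult_left_mono) auto
  also have "\<dots> = X / real n"
    using n0(1) by (simp add: X_def h_def power2_eq_square)
  also have "\<dots> < \<epsilon>"
    using n0 \<open>\<epsilon> > 0\<close> by (simp add: field_simps)
  finally have "norm (Q - g b) < \<epsilon>" using Q(3) by linarith
  moreover have "scal_length a b v = S b"
    unfolding scal_length_def S_def by (rule integral_unique, rule scal_length_eq[OF w(1) vw w(3)]) simp
  ultimately show ?thesis using that Q by metis
qed

lemma steers_curve_endpoint:
  assumes hc: "horizontal_curve SL2 H0 a b g v" and "g a = mat 1" and "\<epsilon> > 0"
  shows "steers (scal_length a b v + \<epsilon>) (g b)"
proof -
  obtain \<delta> where \<delta>: "\<delta> > 0" "\<And>q. q \<in> SL2 \<Longrightarrow> norm (q - mat 1) < \<delta> \<Longrightarrow> steers \<epsilon> q"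
    using steers_near_mat_1[OF \<open>\<epsilon> > 0\<close>] by blast
  have gb: "g b \<in> SL2" using hc unfolding horizontal_curve_def by auto
  define M where "M = norm (g b) + 1"
  have M: "M > 0" by (simp add: M_def add_nonneg_pos)
  obtain Q where Q: "Q \<in> SL2" "steers (scal_length a b v) Q" "norm (Q - g b) < min 1 (\<delta> / M)"
    using steers_approximation[OF assms(1,2), of "min 1 (\<delta> / M)"] \<delta>(1) M by auto
  define R where "R = adjugate Q ** g b"
  have "R \<in> SL2" unfolding R_def by (intro SL2_mult adjugate_SL2 Q gb)
  have "R - mat 1 = adjugate Q ** (g b - Q)"
    by (simp add: R_def matrix_mult.diff_right adjugate_SL2[OF Q(1)])
  then have "norm (R - mat 1) \<le> norm (adjugate Q) * norm (g b - Q)"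
    by (simp only: norm_matrix_mult_le)
  also have "\<dots> \<le> M * norm (Q - g b)"
  proof -
    have "norm Q \<le> M" using Q(3) norm_triangle_ineq[of "Q - g b" "g b"] by (simp add: M_def)
    then show ?thesis by (simp add: norm_minus_commute mult_right_mono)
  qed
  also have "\<dots> < M * (\<delta> / M)" using Q(3) M by (intro mult_strict_left_mono) auto
  finally have "norm (R - mat 1) < \<delta>" using M by simp
  then have "steers \<epsilon> R" using \<delta>(2) \<open>R \<in> SL2\<close> by blast
  moreover have "Q ** R = g b"
    by (simp add: R_def matrix_mul_assoc adjugate_SL2[OF Q(1)])
  ultimately show ?thesis using steers_mult[OF Q(2)] by metis
qed

text \<open>The passage from piecewise smooth to Lipschitz competitors: \<open>rho\<close> remains a lower bound.\<close>

lemma rho_le_scal_length: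
  assumes "horizontal_curve SL2 H0 a b g v" and "g a = mat 1"
  shows "rho (mat 1) (g b) \<le> scal_length a b v"
  by (rule field_le_epsilon) (rule rho_le_steers[OF steers_curve_endpoint[OF assms]])

text \<open>A short curve stays near the unit: the displacement is at most the maximal norm \<open>M\<close> of the curve
  times its length, and for length at most 1/2 this estimate bounds \<open>M\<close> itself.\<close>

lemma norm_curve_minus_mat_1_le:
  assumes hc: "horizontal_curve SL2 H0 a b g v" and "g a = mat 1" and small: "scal_length a b v \<le> 1 / 2"
  shows "norm (g b - mat 1) \<le> 4 * scal_length a b v"
proof -
  have "a < b" and ex: "\<exists>L. L-lipschitz_on {a..b} g"
    using hc unfolding horizontal_curve_def by (simp_all only: simp_thms)
  obtain L where lip: "L-lipschitz_on {a..b} g" using ex ..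
  obtain w K where K: "K > 0" and w: "\<And>t. w t \<in> H0" "\<And>t. norm (w t) \<le> K" "w absolutely_integrable_on {a..b}"
    and vw: "AE t in lebesgue. t \<in> {a..b} \<longrightarrow> v t = w t"
    and int: "\<And>s t. a \<le> s \<Longrightarrow> s \<le> t \<Longrightarrow> t \<le> b \<Longrightarrow> ((\<lambda>r. g r ** w r) has_integral g t - g s) {s..t}"
    by (rule SL2_curve_integral_form[OF hc]) (rule that; assumption)
  define l where "l = integral {a..b} (\<lambda>r. norm (w r))"
  have nint: "(\<lambda>r. norm (w r)) integrable_on {a..b}"
    using w(3) by (auto simp: absolutely_integrable_on_def)
  have "scal_length a b v = sqrt 2 * l"
    unfolding scal_length_def l_def by (rule integral_unique, rule scal_length_eq[OF w(1) vw w(3)]) simp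
  moreover have "l \<ge> 0" unfolding l_def by (intro integral_nonneg nint) auto
  ultimately have l: "0 \<le> l" "l \<le> scal_length a b v"
    using mult_right_mono[of 1 "sqrt 2" l] by auto
  obtain t0 where t0: "t0 \<in> {a..b}" "\<And>t. t \<in> {a..b} \<Longrightarrow> norm (g t) \<le> norm (g t0)"
    using continuous_attains_sup[of "{a..b}" "\<lambda>t. norm (g t)"] \<open>a < b\<close>
      continuous_on_norm[OF lipschitz_on_continuous_on[OF lip]] by auto
  define M where "M = norm (g t0)"
  have bound: "norm (g t - mat 1) \<le> M * l" if t: "t \<in> {a..b}" for t
  proof -
    have has: "((\<lambda>r. g r ** w r) has_integral g t - mat 1) {a..t}"
      using int[of a t] t \<open>g a = mat 1\<close> by simp
    have nint': "(\<lambda>r. norm (w r)) integrable_on {a..t}"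
      by (rule integrable_subinterval_real[OF nint]) (use t in auto)
    have "norm (integral {a..t} (\<lambda>r. g r ** w r)) \<le> integral {a..t} (\<lambda>r. M * norm (w r))"
    proof (rule Henstock_Kurzweil_Integration.integral_norm_bound_integral)
      show "norm (g r ** w r) \<le> M * norm (w r)" if "r \<in> {a..t}" for r
        using norm_matrix_mult_le[of "g r" "w r"] t0(2)[of r] that t unfolding M_def
        by (meson atLeastAtMost_iff mult_right_mono norm_ge_zero order_trans)
      show "(\<lambda>r. g r ** w r) integrable_on {a..t}" using has by blast
      show "(\<lambda>r. M * norm (w r)) integrable_on {a..t}" by (rule integrable_on_mult_right[OF nint'])
    qed
    also have "integral {a..t} (\<lambda>r. M * norm (w r)) = M * integral {a..t} (\<lambda>r. norm (w r))" by simp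
    also have "\<dots> \<le> M * l"
      unfolding l_def using t by (intro mult_left_mono integral_subset_le nint nint') (auto simp: M_def)
    finally show ?thesis using has by (simp add: integral_unique)
  qed
  have "M \<le> norm (g t0 - mat 1) + norm (mat 1 :: cmat)"
    unfolding M_def using norm_triangle_ineq[of "g t0 - mat 1" "mat 1"] by simp
  also have "\<dots> \<le> M * l + 2" using bound[OF t0(1)] norm_mat_1_le by linarith
  also have "M * l \<le> M * (1 / 2)" using l small by (intro mult_left_mono) (auto simp: M_def)
  finally have "M \<le> 4" by simp
  have "norm (g b - mat 1) \<le> M * l" using bound[of b] \<open>a < b\<close> by simp
  also have "\<dots> \<le> 4 * scal_length a b v" using \<open>M \<le> 4\<close> l by (intro mult_mono) auto
  finally show ?thesis .
qed

lemma piecewise_C1_lipschitz: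
  assumes "piecewise_C1 a b g"
  shows "\<exists>L. L-lipschitz_on {a..b} g"
proof -
  from assms obtain n p where p: "p 0 = a" "p n = b" "\<And>i. i < n \<Longrightarrow> p i < p (Suc i)"
    and C1: "\<And>i. i < n \<Longrightarrow> \<exists>D. continuous_on {p i..p (Suc i)} D \<and>
       (\<forall>t\<in>{p i..p (Suc i)}. (g has_vector_derivative D t) (at t within {p i..p (Suc i)}))"
    unfolding piecewise_C1_def by blast
  have "\<exists>L. L-lipschitz_on {a..p i} g" if "i \<le> n" for i
    using that
  proof (induction i)
    case 0
    then show ?case using p by (intro exI[of _ 0] lipschitz_onI) auto
  next
    case (Suc i)
    then obtain L where L: "L-lipschitz_on {a..p i} g" by auto
    obtain D where D: "continuous_on {p i..p (Suc i)} D"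
      "\<And>t. t \<in> {p i..p (Suc i)} \<Longrightarrow> (g has_vector_derivative D t) (at t within {p i..p (Suc i)})"
      using C1[of i] Suc.prems by auto
    have "bounded (D ` {p i..p (Suc i)})"
      using D(1) by (intro compact_imp_bounded compact_continuous_image) auto
    then obtain C where C: "C > 0" "\<And>t. t \<in> {p i..p (Suc i)} \<Longrightarrow> norm (D t) \<le> C"
      by (auto simp: bounded_pos)
    have "C-lipschitz_on {p i..p (Suc i)} g"
    proof (rule bounded_derivative_imp_lipschitz)
      show "(g has_derivative (\<lambda>x. x *\<^sub>R D t)) (at t within {p i..p (Suc i)})"
        if "t \<in> {p i..p (Suc i)}" for t
        using D(2)[OF that] by (simp add: has_vector_derivative_def)
      show "onorm (\<lambda>x. x *\<^sub>R D t) \<le> C" if "t \<in> {p i..p (Suc i)}" for t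
        by (rule onorm_le) (use C(2)[OF that] in \<open>simp add: mult.commute[of C] mult_left_mono\<close>)
    qed (use C in auto)
    from lipschitz_on_concat_max[OF L this refl]
    show ?case by auto
  qed
  from this[of n] show ?thesis using p by simp
qed

text \<open>By \<open>norm_curve_minus_mat_1_le\<close>, the lengths of paths to a point other than the unit are bounded away
  from 0. The curve \<open>g\<close> serves to show that there are such paths at all: the infimum of the empty
  set of reals has no known sign.\<close>

lemma rho_pos:
  assumes hc: "horizontal_curve SL2 H0 a b g v" "g a = mat 1" and "g b \<noteq> mat 1"
  shows "rho (mat 1) (g b) > 0"
proof -
  define m where "m = min (1 / 2) (norm (g b - mat 1) / 4)"
  have "m > 0" using assms(3) by (simp add: m_def)
  define A where "A = {scal_length 0 a u | a f u.
           0 < a \<and> piecewise_C1 0 a f \<and> f ` {0..a} \<subseteq> SL2 \<and> left_control H0 0 a f u \<and>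
           f 0 = mat 1 \<and> f a = g b}"
  obtain l where "reachable l (mat 1 ** g b)"
    using steers_curve_endpoint[OF hc zero_less_one] reachable_mat_1 unfolding steers_def by blast
  then have "A \<noteq> {}" unfolding reachable_def A_def by auto
  moreover have "m \<le> l" if "l \<in> A" for l
  proof -
    from that obtain c f u where l: "l = scal_length 0 c u" and "0 < c" "piecewise_C1 0 c f"
      "f ` {0..c} \<subseteq> SL2" "left_control H0 0 c f u" and f: "f 0 = mat 1" "f c = g b"
      unfolding A_def by blast
    then have "horizontal_curve SL2 H0 0 c f u"
      unfolding horizontal_curve_def using piecewise_C1_lipschitz by blast
    from norm_curve_minus_mat_1_le[OF this f(1)] show ?thesis
      unfolding l m_def f(2) by linarith
  qed
  ultimately have "m \<le> Inf A" by (rule cInf_greatest)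
  then show ?thesis using \<open>m > 0\<close> unfolding rho_def A_def by linarith
qed

section \<open>Nonspacelike curves projected to the special linear group\<close>

lemma lipschitz_on_bilinear:
  fixes F :: "real \<Rightarrow> 'a::real_normed_vector" and G :: "real \<Rightarrow> 'b::real_normed_vector"
    and h :: "'a \<Rightarrow> 'b \<Rightarrow> 'c::real_normed_vector"
  assumes h: "bounded_bilinear h" and "\<exists>L. L-lipschitz_on {a..b} F" "\<exists>L. L-lipschitz_on {a..b} G"
  shows "\<exists>L. L-lipschitz_on {a..b} (\<lambda>t. h (F t) (G t))"
proof -
  obtain L1 where F: "L1-lipschitz_on {a..b} F" using assms(2) ..
  obtain L2 where G: "L2-lipschitz_on {a..b} G" using assms(3) ..
  have L: "L1 \<ge> 0" "L2 \<ge> 0" using F G by (auto dest: lipschitz_on_nonneg)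
  have "bounded (F ` {a..b})" "bounded (G ` {a..b})"
    using lipschitz_on_continuous_on[OF F] lipschitz_on_continuous_on[OF G]
    by (auto intro!: compact_imp_bounded compact_continuous_image)
  then obtain M1 M2 where M: "M1 > 0" "\<And>t. t \<in> {a..b} \<Longrightarrow> norm (F t) \<le> M1"
    "M2 > 0" "\<And>t. t \<in> {a..b} \<Longrightarrow> norm (G t) \<le> M2"
    unfolding bounded_pos by (metis imageI)
  obtain K where K: "K > 0" "\<And>x y. norm (h x y) \<le> norm x * norm y * K"
    using bounded_bilinear.pos_bounded[OF h] by blast
  show ?thesis
  proof (rule exI, rule lipschitz_onI)
    fix s t assume st: "s \<in> {a..b}" "t \<in> {a..b}"
    have "h (F s) (G s) - h (F t) (G t) = h (F s - F t) (G s) + h (F t) (G s - G t)"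
      by (simp add: bounded_bilinear.diff_left[OF h] bounded_bilinear.diff_right[OF h])
    then have "norm (h (F s) (G s) - h (F t) (G t)) \<le> norm (h (F s - F t) (G s)) + norm (h (F t) (G s - G t))"
      by (simp only: norm_triangle_ineq)
    also have "\<dots> \<le> (L1 * norm (s - t)) * M2 * K + M1 * (L2 * norm (s - t)) * K"
    proof (rule add_mono)
      show "norm (h (F s - F t) (G s)) \<le> (L1 * norm (s - t)) * M2 * K"
        by (rule order_trans[OF K(2)], intro mult_right_mono mult_mono lipschitz_on_normD[OF F] st M(4))
           (use K L in auto)
      show "norm (h (F t) (G s - G t)) \<le> M1 * (L2 * norm (s - t)) * K"
        by (rule order_trans[OF K(2)], intro mult_right_mono mult_mono lipschitz_on_normD[OF G] st M(2))
           (use K L M in auto)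
    qed
    also have "\<dots> = (L1 * M2 * K + M1 * L2 * K) * norm (s - t)" by (simp add: algebra_simps)
    finally show "dist (h (F s) (G s)) (h (F t) (G t)) \<le> (L1 * M2 * K + M1 * L2 * K) * dist s t"
      by (simp add: dist_norm)
  qed (use L M K in auto)
qed

lemma lipschitz_on_C1_compose:
  fixes F \<phi> \<phi>' :: "real \<Rightarrow> real"
  assumes "\<exists>L. L-lipschitz_on {a..b} F" and sub: "F ` {a..b} \<subseteq> {p..q}"
    and d: "\<And>x. x \<in> {p..q} \<Longrightarrow> (\<phi> has_real_derivative \<phi>' x) (at x)" and c: "continuous_on {p..q} \<phi>'"
  shows "\<exists>L. L-lipschitz_on {a..b} (\<lambda>t. \<phi> (F t))"
proof -
  obtain L where L: "L-lipschitz_on {a..b} F" using assms(1) ..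
  have "bounded (\<phi>' ` {p..q})"
    using c by (intro compact_imp_bounded compact_continuous_image) auto
  then obtain C where C: "C > 0" "\<forall>y\<in>\<phi>' ` {p..q}. norm y \<le> C" unfolding bounded_pos by blast
  have "C-lipschitz_on {p..q} \<phi>"
  proof (rule bounded_derivative_imp_lipschitz)
    show "(\<phi> has_derivative (*) (\<phi>' x)) (at x within {p..q})" if "x \<in> {p..q}" for x
      using d[OF that] by (simp add: has_field_derivative_def has_derivative_at_withinI)
    show "onorm ((*) (\<phi>' x)) \<le> C" if "x \<in> {p..q}" for x
      by (rule onorm_le) (use C that in \<open>auto simp: abs_mult intro!: mult_right_mono\<close>)
  qed (use C in auto)
  then have "C-lipschitz_on (F ` {a..b}) \<phi>" using sub by (rule lipschitz_on_subset)
  from lipschitz_on_compose2[OF L this] show ?thesis by blast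
qed

lemma lipschitz_on_entry:
  fixes f :: "real \<Rightarrow> cmat"
  assumes "\<exists>L. L-lipschitz_on S f"
  shows "\<exists>L. L-lipschitz_on S (\<lambda>t. f t $ i $ j)"
proof -
  obtain L where L: "L-lipschitz_on S f" using assms ..
  have "L-lipschitz_on S (\<lambda>t. f t $ i $ j)"
  proof (rule lipschitz_onI)
    fix s t assume st: "s \<in> S" "t \<in> S"
    have "norm ((f s - f t) $ i $ j) \<le> norm (f s - f t)"
      using Finite_Cartesian_Product.norm_nth_le[of "(f s - f t) $ i" j]
        Finite_Cartesian_Product.norm_nth_le[of "f s - f t" i] by linarith
    then show "dist (f s $ i $ j) (f t $ i $ j) \<le> L * dist s t"
      using lipschitz_onD[OF L st] by (simp add: dist_norm)
  qed (rule lipschitz_on_nonneg[OF L])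
  then show ?thesis ..
qed

lemma has_integral_le_AE:
  fixes f g :: "real \<Rightarrow> real"
  assumes f: "(f has_integral i) S" and g: "(g has_integral j) S"
    and le: "AE t in lebesgue. t \<in> S \<longrightarrow> f t \<le> g t"
  shows "i \<le> j"
proof (rule has_integral_le[OF f])
  have N: "negligible {t. \<not> (t \<in> S \<longrightarrow> f t \<le> g t)}" using le unfolding AE_lebesgue_negligible .
  show "((\<lambda>t. max (f t) (g t)) has_integral j) S"
    by (rule has_integral_spike[OF N _ g]) auto
qed simp

lemma pseudo_prod_e0 [simp]: "pseudo_prod u e0 = x0 u"
  using coords_combination[of 1 0 0 0] by (simp add: pseudo_prod_def)

lemma pseudo_prod_decomposition:
  assumes "u \<in> H"
  shows "pseudo_prod u u = (x0 u)\<^sup>2 - scal_prod (u - x0 u *\<^sub>R e0) (u - x0 u *\<^sub>R e0)"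
  unfolding scal_prod_def H_decomposition[OF assms] pseudo_prod_def by (simp add: power2_eq_square)

lemma GLp_det: "A \<in> GLp \<Longrightarrow> det A = of_real (Re (det A))"
  by (simp add: GLp_def complex_is_Real_iff complex_eq_iff)

lemma det_scaleR_cmat: "det (r *\<^sub>R (A :: cmat)) = of_real (r\<^sup>2) * det A"
  unfolding det_2 vector_scaleR_component by (simp add: scaleR_conv_of_real power2_eq_square algebra_simps)

lemma normalized_SL2:
  assumes "A \<in> GLp"
  shows "exp (- (ln (Re (det A)) / 2)) *\<^sub>R A \<in> SL2"
proof -
  define d where "d = Re (det A)"
  have d: "d > 0" "det A = of_real d"
    using assms by (simp add: GLp_def d_def, simp only: d_def GLp_det[OF assms, symmetric])
  have "(exp (- (ln d / 2)))\<^sup>2 = exp (2 * (- (ln d / 2)))"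
    by (simp only: exp_double)
  also have "2 * (- (ln d / 2)) = - ln d" by simp
  also have "exp (- ln d) = 1 / d" using d(1) by (simp only: exp_minus exp_ln inverse_eq_divide)
  finally have sq: "(exp (- (ln d / 2)))\<^sup>2 = 1 / d" .
  have "det (exp (- (ln d / 2)) *\<^sub>R A) = of_real (1 / d) * of_real d"
    unfolding det_scaleR_cmat d(2) sq ..
  also have "\<dots> = of_real (1 / d * d)" by (simp only: of_real_mult)
  also have "1 / d * d = 1" using d(1) by simp
  finally show ?thesis unfolding SL2_def d_def by simp
qed

text \<open>The derivative of the determinant is the determinant times the trace of the control. Hence the
  logarithm of the determinant grows at the rate \<open>x0 (u t)\<close>, and rescaling to determinant 1 removes
  from the control exactly its component along \<open>e0\<close>.\<close>

lemma curve_normalization: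
  assumes hc: "horizontal_curve GLp H a b f u" and f0: "f a = mat 1"
  defines "\<xi> \<equiv> ln (Re (det (f b)))"
    and "\<gamma> \<equiv> \<lambda>t. exp (- (ln (Re (det (f t))) / 2)) *\<^sub>R f t"
    and "v \<equiv> \<lambda>t. u t - x0 (u t) *\<^sub>R e0"
  shows "horizontal_curve SL2 H0 a b \<gamma> v" "\<gamma> a = mat 1" "f b = exp (\<xi> / 2) *\<^sub>R \<gamma> b"
    "((\<lambda>t. x0 (u t)) has_integral \<xi>) {a..b}"
proof -
  have "a < b" and ex: "\<exists>L. L-lipschitz_on {a..b} f" and GL: "f ` {a..b} \<subseteq> GLp"
    and ctrl: "AE t in lebesgue. t \<in> {a..b} \<longrightarrow> u t \<in> H \<and> (f has_vector_derivative (f t ** u t)) (at t within {a..b})"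
    using hc unfolding horizontal_curve_def left_control_def by (simp_all only: simp_thms)
  define d where "d t = Re (det (f t))" for t
  define s where "s t = ln (d t)" for t
  have d_pos: "d t > 0" if "t \<in> {a..b}" for t
    using GL that by (auto simp: GLp_def d_def image_subset_iff)
  have d_eq: "d t = Re (f t $ 1 $ 1 * f t $ 2 $ 2 - f t $ 1 $ 2 * f t $ 2 $ 1)" for t
    by (simp add: d_def det_2)
  have prod_lip: "\<exists>L. L-lipschitz_on {a..b} (\<lambda>t. f t $ i $ j * f t $ k $ l)" for i j k l
    by (rule lipschitz_on_bilinear[OF bounded_bilinear_mult lipschitz_on_entry[OF ex] lipschitz_on_entry[OF ex]])
  obtain L1 where L1: "L1-lipschitz_on {a..b} (\<lambda>t. f t $ 1 $ 1 * f t $ 2 $ 2)" using prod_lip ..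
  obtain L2 where L2: "L2-lipschitz_on {a..b} (\<lambda>t. f t $ 1 $ 2 * f t $ 2 $ 1)" using prod_lip ..
  from lipschitz_on_diff[OF L1 L2] have L: "(L1 + L2)-lipschitz_on {a..b}
    (\<lambda>t. f t $ 1 $ 1 * f t $ 2 $ 2 - f t $ 1 $ 2 * f t $ 2 $ 1)" .
  have d_lip: "(L1 + L2)-lipschitz_on {a..b} d"
  proof (rule lipschitz_onI)
    fix s t assume "s \<in> {a..b}" "t \<in> {a..b}"
    from lipschitz_onD[OF L this] show "dist (d s) (d t) \<le> (L1 + L2) * dist s t"
      unfolding d_eq dist_norm minus_complex.sel(1)[symmetric] real_norm_def
      using abs_Re_le_cmod order_trans by blast
  qed (rule lipschitz_on_nonneg[OF L])
  have d_cont: "continuous_on {a..b} d" by (rule lipschitz_on_continuous_on[OF d_lip])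
  obtain t1 where t1: "t1 \<in> {a..b}" "\<And>t. t \<in> {a..b} \<Longrightarrow> d t1 \<le> d t"
    using continuous_attains_inf[of "{a..b}" d] d_cont \<open>a < b\<close> by auto
  obtain t2 where t2: "t2 \<in> {a..b}" "\<And>t. t \<in> {a..b} \<Longrightarrow> d t \<le> d t2"
    using continuous_attains_sup[of "{a..b}" d] d_cont \<open>a < b\<close> by auto
  have s_ex: "\<exists>L. L-lipschitz_on {a..b} s"
    unfolding s_def
  proof (rule lipschitz_on_C1_compose[where F = d and p = "d t1" and q = "d t2" and \<phi> = ln and \<phi>' = inverse])
    show "\<exists>L. L-lipschitz_on {a..b} d" using d_lip ..
    show "d ` {a..b} \<subseteq> {d t1..d t2}" using t1 t2 by auto
    show "(ln has_real_derivative inverse x) (at x)" if "x \<in> {d t1..d t2}" for x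
      using that d_pos[OF t1(1)] by (intro DERIV_ln) auto
    show "continuous_on {d t1..d t2} inverse"
      using d_pos[OF t1(1)] by (intro continuous_intros) auto
  qed
  then obtain Ls where s_lip: "Ls-lipschitz_on {a..b} s" ..
  define e where "e t = exp (- (s t / 2))" for t
  have e_ex: "\<exists>L. L-lipschitz_on {a..b} e"
    unfolding e_def
  proof (rule lipschitz_on_C1_compose[OF s_ex, where p = "ln (d t1)" and q = "ln (d t2)" and \<phi> = "\<lambda>x. exp (- (x / 2))" and \<phi>' = "\<lambda>x. - exp (- (x / 2)) / 2"])
    show "s ` {a..b} \<subseteq> {ln (d t1)..ln (d t2)}"
      using t1 t2 d_pos by (auto simp: s_def)
  qed (auto intro!: derivative_eq_intros continuous_intros)
  have \<gamma>: "\<gamma> t = e t *\<^sub>R f t" for t by (simp add: \<gamma>_def e_def s_def d_def)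
  have deriv: "AE t in lebesgue. t \<in> {a..b} \<longrightarrow>
     (s has_vector_derivative x0 (u t)) (at t within {a..b}) \<and>
     (\<gamma> has_vector_derivative \<gamma> t ** v t) (at t within {a..b}) \<and> v t \<in> H0"
    using ctrl
  proof eventually_elim
    case (elim t)
    show ?case
    proof
      assume t: "t \<in> {a..b}"
      then have uH: "u t \<in> H" and f': "(f has_vector_derivative (f t ** u t)) (at t within {a..b})"
        using elim by auto
      have ent: "((\<lambda>t. f t $ i $ j) has_vector_derivative (f t ** u t) $ i $ j) (at t within {a..b})" for i j
        by (rule bounded_linear.has_vector_derivative[OF bounded_linear_vec_nth,
              OF bounded_linear.has_vector_derivative[OF bounded_linear_vec_nth f']])
      have tr: "u t $ 1 $ 1 + u t $ 2 $ 2 = of_real (x0 (u t))"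
        using uH unfolding H_iff by (simp add: x0_def complex_eq_iff)
      have det: "f t $ 1 $ 1 * f t $ 2 $ 2 - f t $ 1 $ 2 * f t $ 2 $ 1 = of_real (d t)"
      proof -
        have "f t \<in> GLp" using GL t by blast
        from GLp_det[OF this] show ?thesis by (simp only: d_def det_2)
      qed
      have "((\<lambda>t. f t $ 1 $ 1 * f t $ 2 $ 2 - f t $ 1 $ 2 * f t $ 2 $ 1) has_vector_derivative
          (f t $ 1 $ 1 * (f t ** u t) $ 2 $ 2 + (f t ** u t) $ 1 $ 1 * f t $ 2 $ 2)
          - (f t $ 1 $ 2 * (f t ** u t) $ 2 $ 1 + (f t ** u t) $ 1 $ 2 * f t $ 2 $ 1)) (at t within {a..b})"
        by (intro has_vector_derivative_diff has_vector_derivative_mult ent)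
      also have "(f t $ 1 $ 1 * (f t ** u t) $ 2 $ 2 + (f t ** u t) $ 1 $ 1 * f t $ 2 $ 2)
          - (f t $ 1 $ 2 * (f t ** u t) $ 2 $ 1 + (f t ** u t) $ 1 $ 2 * f t $ 2 $ 1)
          = (f t $ 1 $ 1 * f t $ 2 $ 2 - f t $ 1 $ 2 * f t $ 2 $ 1) * (u t $ 1 $ 1 + u t $ 2 $ 2)"
        by (simp add: matrix_mult_entries algebra_simps)
      finally have "((\<lambda>t. f t $ 1 $ 1 * f t $ 2 $ 2 - f t $ 1 $ 2 * f t $ 2 $ 1) has_vector_derivative
          of_real (d t) * of_real (x0 (u t))) (at t within {a..b})"
        unfolding det tr .
      from bounded_linear.has_vector_derivative[OF bounded_linear_Re this]
      have "(d has_vector_derivative d t * x0 (u t)) (at t within {a..b})"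
        unfolding d_eq[symmetric] by (simp flip: of_real_mult)
      then have "(d has_real_derivative d t * x0 (u t)) (at t within {a..b})"
        by (simp add: has_real_derivative_iff_has_vector_derivative)
      then have s': "(s has_real_derivative x0 (u t)) (at t within {a..b})"
        unfolding s_def[abs_def] using d_pos[OF t] by (auto intro!: derivative_eq_intros)
      then have "(e has_real_derivative - (x0 (u t) / 2) * e t) (at t within {a..b})"
        unfolding e_def[abs_def] by (auto intro!: derivative_eq_intros)
      from has_vector_derivative_scaleR[OF this f']
      have "(\<gamma> has_vector_derivative e t *\<^sub>R (f t ** u t) + (- (x0 (u t) / 2) * e t) *\<^sub>R f t) (at t within {a..b})"
        unfolding \<gamma>[abs_def] .
      moreover have "e t *\<^sub>R (f t ** u t) + (- (x0 (u t) / 2) * e t) *\<^sub>R f t = \<gamma> t ** v t"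
        by (simp add: \<gamma> v_def e0_def matrix_mult.diff_right matrix_mult.scaleR_left matrix_mult.scaleR_right
            scaleR_diff_right mult.commute)
      ultimately have "(\<gamma> has_vector_derivative \<gamma> t ** v t) (at t within {a..b})" by simp
      then show "(s has_vector_derivative x0 (u t)) (at t within {a..b}) \<and>
         (\<gamma> has_vector_derivative \<gamma> t ** v t) (at t within {a..b}) \<and> v t \<in> H0"
        using s' H_decomposition(1)[OF uH]
        by (simp add: v_def has_real_derivative_iff_has_vector_derivative)
    qed
  qed
  show "horizontal_curve SL2 H0 a b \<gamma> v"
    unfolding horizontal_curve_def
  proof (intro conjI)
    show "\<exists>L. L-lipschitz_on {a..b} \<gamma>"
      unfolding \<gamma>[abs_def] by (rule lipschitz_on_bilinear[OF bounded_bilinear_scaleR e_ex ex])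
    show "\<gamma> ` {a..b} \<subseteq> SL2"
      using GL normalized_SL2 by (auto simp: \<gamma>_def)
    show "left_control H0 a b \<gamma> v"
      unfolding left_control_def using deriv by eventually_elim auto
  qed fact
  show "\<gamma> a = mat 1" by (simp add: \<gamma>_def f0)
  show "f b = exp (\<xi> / 2) *\<^sub>R \<gamma> b"
    by (simp add: \<gamma>_def \<xi>_def flip: exp_add)
  have "((\<lambda>t. x0 (u t)) has_integral s b - s a) {a..b}"
    by (rule lipschitz_fundamental_theorem(1)[OF _ s_lip])
       (use \<open>a < b\<close> in simp, use deriv in \<open>eventually_elim, blast\<close>)
  moreover have "s a = 0" "s b = \<xi>" by (simp_all add: s_def d_def f0 \<xi>_def)
  ultimately show "((\<lambda>t. x0 (u t)) has_integral \<xi>) {a..b}" by simp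
qed

text \<open>The reversed Cauchy-Schwarz inequality against the unit timelike vector \<open>(cosh c, sinh c)\<close>: the
  difference of the squares is the square of \<open>x sinh c - r cosh c\<close>.\<close>

lemma lorentz_boost_inequality:
  fixes x r c :: real
  assumes "0 \<le> r" "r \<le> x" "0 \<le> c"
  shows "sqrt (x\<^sup>2 - r\<^sup>2) \<le> x * cosh c - r * sinh c"
proof (rule real_le_lsqrt)
  have "r * sinh c \<le> x * cosh c"
    using assms sinh_le_cosh_real[of c] by (intro mult_mono) auto
  then show "0 \<le> x * cosh c - r * sinh c" by simp
  have "(x * cosh c - r * sinh c)\<^sup>2 - (x\<^sup>2 - r\<^sup>2) = (x * sinh c - r * cosh c)\<^sup>2"
    using cosh_square_eq[of c] by algebra
  then show "x\<^sup>2 - r\<^sup>2 \<le> (x * cosh c - r * sinh c)\<^sup>2"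
    using zero_le_power2[of "x * sinh c - r * cosh c"] by linarith
qed

text \<open>All that the theorem needs to know about competing curves. The boost inequality is integrated for
  each fixed \<open>c\<close>, which replaces a Minkowski inequality for integrals and also treats the isotropic
  case.\<close>

lemma fd_nonspacelike_curve_bounds:
  assumes fd: "fd_nonspacelike_curve a b f u" and f0: "f a = mat 1"
  obtains \<xi> g1 where "f b = exp (\<xi> / 2) *\<^sub>R g1" "g1 \<in> SL2" "rho (mat 1) g1 \<le> \<xi>"
    "g1 \<noteq> mat 1 \<Longrightarrow> rho (mat 1) g1 > 0"
    "\<And>c. c \<ge> 0 \<Longrightarrow> rho (mat 1) g1 \<ge> 0 \<Longrightarrow> lorentz_length a b u \<le> \<xi> * cosh c - rho (mat 1) g1 * sinh c"
proof -
  have hc: "horizontal_curve GLp H a b f u" and ns: "nonspacelike a b u" and fut: "future_directed a b u"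
    using fd unfolding fd_nonspacelike_curve_def by auto
  define \<xi> where "\<xi> = ln (Re (det (f b)))"
  define \<gamma> where "\<gamma> t = exp (- (ln (Re (det (f t))) / 2)) *\<^sub>R f t" for t
  define v where "v t = u t - x0 (u t) *\<^sub>R e0" for t
  have norm: "horizontal_curve SL2 H0 a b \<gamma> v" "\<gamma> a = mat 1" "f b = exp (\<xi> / 2) *\<^sub>R \<gamma> b"
    "((\<lambda>t. x0 (u t)) has_integral \<xi>) {a..b}"
    using curve_normalization[OF hc f0]
    unfolding \<xi>_def \<gamma>_def[abs_def] v_def[abs_def] by blast+
  define r where "r t = sqrt (scal_prod (v t) (v t))" for t
  have pt: "AE t in lebesgue. t \<in> {a..b} \<longrightarrow> pseudo_prod (u t) (u t) = (x0 (u t))\<^sup>2 - (r t)\<^sup>2 \<and> r t \<le> x0 (u t)"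
  proof -
    have "AE t in lebesgue. t \<in> {a..b} \<longrightarrow> u t \<in> H"
      using hc unfolding horizontal_curve_def left_control_def by (auto elim: eventually_mono)
    then show ?thesis
      using ns[unfolded nonspacelike_def] fut[unfolded future_directed_def]
    proof eventually_elim
      case (elim t)
      show ?case
      proof
        assume t: "t \<in> {a..b}"
        have eq: "pseudo_prod (u t) (u t) = (x0 (u t))\<^sup>2 - (r t)\<^sup>2"
          using pseudo_prod_decomposition[of "u t"] elim t by (simp add: r_def v_def scal_prod_nonneg)
        moreover have "r t \<le> x0 (u t)"
          by (rule power2_le_imp_le) (use elim t eq in auto)
        ultimately show "pseudo_prod (u t) (u t) = (x0 (u t))\<^sup>2 - (r t)\<^sup>2 \<and> r t \<le> x0 (u t)" ..
      qed
    qed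
  qed
  define l where "l = scal_length a b v"
  have r_int: "(r has_integral l) {a..b}"
  proof -
    obtain w K where "K > 0" and w: "\<And>t. w t \<in> H0" "\<And>t. norm (w t) \<le> K" "w absolutely_integrable_on {a..b}"
      and vw: "AE t in lebesgue. t \<in> {a..b} \<longrightarrow> v t = w t"
      and "\<And>s t. a \<le> s \<Longrightarrow> s \<le> t \<Longrightarrow> t \<le> b \<Longrightarrow> ((\<lambda>r. \<gamma> r ** w r) has_integral \<gamma> t - \<gamma> s) {s..t}"
      by (rule SL2_curve_integral_form[OF norm(1)]) (rule that; assumption)
    have "r integrable_on {a..b}"
      using scal_length_eq[OF w(1) vw w(3) order_refl] unfolding r_def[abs_def] by blast
    then show ?thesis unfolding l_def scal_length_def r_def[abs_def] by (rule integrable_integral)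
  qed
  have rho_l: "rho (mat 1) (\<gamma> b) \<le> l"
    unfolding l_def by (rule rho_le_scal_length[OF norm(1,2)])
  have "l \<le> \<xi>"
    by (rule has_integral_le_AE[OF r_int norm(4)]) (use pt in \<open>eventually_elim, blast\<close>)
  show ?thesis
  proof (rule that[of \<xi> "\<gamma> b"])
    show "f b = exp (\<xi> / 2) *\<^sub>R \<gamma> b" by (rule norm(3))
    show "\<gamma> b \<in> SL2" using norm(1) unfolding horizontal_curve_def by auto
    show "rho (mat 1) (\<gamma> b) \<le> \<xi>" using rho_l \<open>l \<le> \<xi>\<close> by simp
    show "rho (mat 1) (\<gamma> b) > 0" if "\<gamma> b \<noteq> mat 1" by (rule rho_pos[OF norm(1,2) that])
    fix c :: real assume c: "c \<ge> 0" and rho0: "rho (mat 1) (\<gamma> b) \<ge> 0"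
    have "l * sinh c \<ge> rho (mat 1) (\<gamma> b) * sinh c" using c rho_l by (intro mult_right_mono) auto
    moreover have "lorentz_length a b u \<le> \<xi> * cosh c - l * sinh c"
    proof (cases "(\<lambda>t. sqrt (pseudo_prod (u t) (u t))) integrable_on {a..b}")
      case True
      then have 1: "((\<lambda>t. sqrt (pseudo_prod (u t) (u t))) has_integral lorentz_length a b u) {a..b}"
        unfolding lorentz_length_def by (rule integrable_integral)
      have 2: "((\<lambda>t. x0 (u t) * cosh c - r t * sinh c) has_integral \<xi> * cosh c - l * sinh c) {a..b}"
        by (intro has_integral_diff has_integral_mult_left norm(4) r_int)
      show ?thesis
      proof (rule has_integral_le_AE[OF 1 2])
        show "AE t in lebesgue. t \<in> {a..b} \<longrightarrow> sqrt (pseudo_prod (u t) (u t)) \<le> x0 (u t) * cosh c - r t * sinh c"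
          using pt
        proof eventually_elim
          case (elim t)
          then show ?case
            using lorentz_boost_inequality[of "r t" "x0 (u t)" c] c by (auto simp: r_def scal_prod_nonneg)
        qed
      qed
    next
      case False
      \<comment> \<open>The integral of a function that is not integrable is 0 by convention.\<close>
      then have "lorentz_length a b u = 0"
        unfolding lorentz_length_def by (rule not_integrable_integral)
      moreover have "l * sinh c \<le> \<xi> * cosh c"
        using \<open>l \<le> \<xi>\<close> rho_l rho0 c sinh_le_cosh_real[of c] by (intro mult_mono) auto
      ultimately show ?thesis by simp
    qed
    ultimately show "lorentz_length a b u \<le> \<xi> * cosh c - rho (mat 1) (\<gamma> b) * sinh c" by linarith
  qed
qed

lemma decomposition_unique:
  fixes \<xi> \<zeta> :: real
  assumes "exp (\<xi> / 2) *\<^sub>R g1 = exp (\<zeta> / 2) *\<^sub>R h1" "g1 \<in> SL2" "h1 \<in> SL2"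
  shows "\<xi> = \<zeta>" "g1 = h1"
proof -
  have "det (exp (\<xi> / 2) *\<^sub>R g1) = det (exp (\<zeta> / 2) *\<^sub>R h1)" using assms(1) by simp
  then have "complex_of_real ((exp (\<xi> / 2))\<^sup>2) = of_real ((exp (\<zeta> / 2))\<^sup>2)"
    using assms(2,3) unfolding det_scaleR_cmat SL2_def by simp
  then have "(exp (\<xi> / 2))\<^sup>2 = (exp (\<zeta> / 2))\<^sup>2" by (simp only: of_real_eq_iff)
  then have "exp (\<xi> / 2) = exp (\<zeta> / 2)" by (rule power2_eq_imp_eq) simp_all
  then show "\<xi> = \<zeta>" by simp
  then show "g1 = h1" using assms(1) by simp
qed

section \<open>The longest arcs\<close>

lemma AE_scale:
  fixes P :: "real \<Rightarrow> bool"
  assumes "AE t in lebesgue. P t" "\<beta> > 0"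
  shows "AE t in lebesgue. P (\<beta> * t)"
proof -
  have "negligible {t. \<not> P t}" using assms(1) unfolding AE_lebesgue_negligible .
  then have "negligible ((\<lambda>t. t / \<beta>) ` {t. \<not> P t})"
    by (rule negligible_differentiable_image_negligible[rotated])
       (use assms(2) in \<open>auto intro!: differentiable_at_imp_differentiable_on derivative_intros\<close>)
  moreover have "{t. \<not> P (\<beta> * t)} \<subseteq> (\<lambda>t. t / \<beta>) ` {t. \<not> P t}"
  proof
    fix t assume "t \<in> {t. \<not> P (\<beta> * t)}"
    then show "t \<in> (\<lambda>t. t / \<beta>) ` {t. \<not> P t}"
      using assms(2) by (intro image_eqI[of _ _ "\<beta> * t"]) auto
  qed
  ultimately show ?thesis unfolding AE_lebesgue_negligible by (rule negligible_subset)
qed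

text \<open>The common construction of both kinds of longest arcs: \<open>\<alpha> = cosh c\<close>, \<open>\<beta> = sinh c\<close> for the timelike
  ones and \<open>\<alpha> = \<beta> = 1\<close> for the isotropic ones.\<close>

lemma scaled_arc:
  assumes sa: "shortest_arc 0 \<eta> \<gamma> v" and al: "arclength_parametrized 0 \<eta> v"
    and \<beta>: "\<beta> > 0" "\<eta> = \<beta> * k" and \<alpha>: "\<alpha> \<ge> \<beta>"
  defines "f \<equiv> \<lambda>t. exp (\<alpha> * t / 2) *\<^sub>R \<gamma> (\<beta> * t)"
    and "u \<equiv> \<lambda>t. \<alpha> *\<^sub>R e0 + \<beta> *\<^sub>R v (\<beta> * t)"
  shows "fd_nonspacelike_curve 0 k f u" "lorentz_length 0 k u = k * sqrt (\<alpha>\<^sup>2 - \<beta>\<^sup>2)"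
    "AE t in lebesgue. t \<in> {0..k} \<longrightarrow> pseudo_prod (u t) (u t) = \<alpha>\<^sup>2 - \<beta>\<^sup>2 \<and> u t \<noteq> 0"
proof -
  have hc: "horizontal_curve SL2 H0 0 \<eta> \<gamma> v" using sa unfolding shortest_arc_def by blast
  have "0 < \<eta>" and ex: "\<exists>L. L-lipschitz_on {0..\<eta>} \<gamma>" and SL2: "\<gamma> ` {0..\<eta>} \<subseteq> SL2"
    and ctrl: "AE t in lebesgue. t \<in> {0..\<eta>} \<longrightarrow> v t \<in> H0 \<and> (\<gamma> has_vector_derivative (\<gamma> t ** v t)) (at t within {0..\<eta>})"
    using hc unfolding horizontal_curve_def left_control_def by (simp_all only: simp_thms)
  then have k: "k > 0" using \<beta> by (simp add: zero_less_mult_iff)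
  have "\<alpha> > 0" using \<alpha> \<beta> by simp
  have in_iv: "\<beta> * t \<in> {0..\<eta>}" if "t \<in> {0..k}" for t using that \<beta> by auto
  have unit: "AE t in lebesgue. t \<in> {0..\<eta>} \<longrightarrow> sqrt (scal_prod (v t) (v t)) = 1"
  proof (rule eq_1_AE_if_indefinite_integral_id)
    obtain w K where "K > 0" and w: "\<And>t. w t \<in> H0" "\<And>t. norm (w t) \<le> K" "w absolutely_integrable_on {0..\<eta>}"
      and vw: "AE t in lebesgue. t \<in> {0..\<eta>} \<longrightarrow> v t = w t"
      and "\<And>s t. 0 \<le> s \<Longrightarrow> s \<le> t \<Longrightarrow> t \<le> \<eta> \<Longrightarrow> ((\<lambda>r. \<gamma> r ** w r) has_integral \<gamma> t - \<gamma> s) {s..t}"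
      by (rule SL2_curve_integral_form[OF hc]) (rule that; assumption)
    show "(\<lambda>t. sqrt (scal_prod (v t) (v t))) integrable_on {0..\<eta>}"
      using scal_length_eq[OF w(1) vw w(3) order_refl] by blast
    show "integral {0..t} (\<lambda>t. sqrt (scal_prod (v t) (v t))) = t - 0" if "t \<in> {0..\<eta>}" for t
      using al that unfolding arclength_parametrized_def scal_length_def by blast
  qed (simp add: scal_prod_nonneg)
  have pt: "AE t in lebesgue. t \<in> {0..k} \<longrightarrow> v (\<beta> * t) \<in> H0 \<and> scal_prod (v (\<beta> * t)) (v (\<beta> * t)) = 1 \<and>
      (\<gamma> has_vector_derivative (\<gamma> (\<beta> * t) ** v (\<beta> * t))) (at (\<beta> * t) within {0..\<eta>})"
    using AE_scale[OF ctrl \<beta>(1)] AE_scale[OF unit \<beta>(1)] by eventually_elim (use in_iv in auto)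
  have u: "pseudo_prod (u t) (u t) = \<alpha>\<^sup>2 - \<beta>\<^sup>2" "x0 (u t) = \<alpha>" "u t \<in> H"
    if "v (\<beta> * t) \<in> H0" "scal_prod (v (\<beta> * t)) (v (\<beta> * t)) = 1" for t
  proof -
    show uH: "u t \<in> H"
      using that(1) H0_subset_H unfolding u_def H_def
      by (intro span_add span_scale) (auto intro: span_base)
    have e0: "x0 e0 = 1" using coords_combination(1)[of 1 0 0 0] by simp
    have "x0 (v (\<beta> * t)) = 0" using that(1) unfolding H0_iff by (simp add: x0_def)
    moreover have "x0 (u t) = \<alpha> * x0 e0 + \<beta> * x0 (v (\<beta> * t))"
      by (simp add: u_def x0_def algebra_simps)
    ultimately show x0: "x0 (u t) = \<alpha>" using e0 by simp
    have "scal_prod (\<beta> *\<^sub>R v (\<beta> * t)) (\<beta> *\<^sub>R v (\<beta> * t)) = \<beta>\<^sup>2 * scal_prod (v (\<beta> * t)) (v (\<beta> * t))"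
      by (simp add: scal_prod_def x1_def x2_def x3_def power2_eq_square algebra_simps)
    then show "pseudo_prod (u t) (u t) = \<alpha>\<^sup>2 - \<beta>\<^sup>2"
      unfolding pseudo_prod_decomposition[OF uH] x0 using that(2) by (simp add: u_def)
  qed
  show "AE t in lebesgue. t \<in> {0..k} \<longrightarrow> pseudo_prod (u t) (u t) = \<alpha>\<^sup>2 - \<beta>\<^sup>2 \<and> u t \<noteq> 0"
    using pt
  proof eventually_elim
    case (elim t)
    then show ?case using u(1,2)[of t] \<open>\<alpha> > 0\<close> by (auto simp: x0_def)
  qed
  have "((\<lambda>t. sqrt (pseudo_prod (u t) (u t))) has_integral k * sqrt (\<alpha>\<^sup>2 - \<beta>\<^sup>2)) {0..k}"
  proof (rule has_integral_spike)
    show "negligible {t. \<not> (t \<in> {0..k} \<longrightarrow> v (\<beta> * t) \<in> H0 \<and> scal_prod (v (\<beta> * t)) (v (\<beta> * t)) = 1 \<and>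
      (\<gamma> has_vector_derivative (\<gamma> (\<beta> * t) ** v (\<beta> * t))) (at (\<beta> * t) within {0..\<eta>}))}"
      using pt unfolding AE_lebesgue_negligible .
    show "((\<lambda>t. sqrt (\<alpha>\<^sup>2 - \<beta>\<^sup>2)) has_integral k * sqrt (\<alpha>\<^sup>2 - \<beta>\<^sup>2)) {0..k}"
      using has_integral_const_real[of "sqrt (\<alpha>\<^sup>2 - \<beta>\<^sup>2)" 0 k] k by simp
  qed (use u(1) in auto)
  then show "lorentz_length 0 k u = k * sqrt (\<alpha>\<^sup>2 - \<beta>\<^sup>2)"
    unfolding lorentz_length_def by (rule integral_unique)
  have "\<exists>L. L-lipschitz_on {0..k} (\<lambda>t. \<gamma> (\<beta> * t))"
  proof -
    obtain L where L: "L-lipschitz_on {0..\<eta>} \<gamma>" using ex ..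
    have "(\<beta> * L)-lipschitz_on {0..k} (\<lambda>t. \<gamma> (\<beta> * t))"
    proof (rule lipschitz_onI)
      fix s t assume "s \<in> {0..k}" "t \<in> {0..k}"
      from lipschitz_onD[OF L in_iv[OF this(1)] in_iv[OF this(2)]]
      show "dist (\<gamma> (\<beta> * s)) (\<gamma> (\<beta> * t)) \<le> \<beta> * L * dist s t"
        using \<beta>(1) by (simp add: dist_real_def abs_mult mult_ac flip: right_diff_distrib)
    qed (use lipschitz_on_nonneg[OF L] \<beta> in auto)
    then show ?thesis ..
  qed
  note \<gamma>_lip = this
  have exp_lip: "\<exists>L. L-lipschitz_on {0..k} (\<lambda>t. exp (\<alpha> * t / 2))"
  proof (rule lipschitz_on_C1_compose[where F = "\<lambda>t. t" and p = 0 and q = k and \<phi> = "\<lambda>t. exp (\<alpha> * t / 2)"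
            and \<phi>' = "\<lambda>t. exp (\<alpha> * t / 2) * (\<alpha> / 2)"])
    show "\<exists>L. L-lipschitz_on {0..k} (\<lambda>t. t)" using lipschitz_on_id by blast
    show "((\<lambda>t. exp (\<alpha> * t / 2)) has_real_derivative exp (\<alpha> * t / 2) * (\<alpha> / 2)) (at t)" for t
      by (auto intro!: derivative_eq_intros)
    show "continuous_on {0..k} (\<lambda>t. exp (\<alpha> * t / 2) * (\<alpha> / 2))"
      by (intro continuous_intros) auto
  qed simp
  have lip: "\<exists>L. L-lipschitz_on {0..k} f"
    unfolding f_def by (rule lipschitz_on_bilinear[OF bounded_bilinear_scaleR exp_lip \<gamma>_lip])
  have "f ` {0..k} \<subseteq> GLp"
  proof
    fix y assume "y \<in> f ` {0..k}"
    then obtain t where t: "t \<in> {0..k}" "y = f t" by blast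
    have "det (\<gamma> (\<beta> * t)) = 1" using SL2 in_iv[OF t(1)] by (auto simp: SL2_def image_subset_iff)
    then have "det y = of_real ((exp (\<alpha> * t / 2))\<^sup>2)" unfolding t f_def det_scaleR_cmat by simp
    then show "y \<in> GLp" by (simp only: GLp_def mem_Collect_eq) simp
  qed
  moreover have "left_control H 0 k f u"
    unfolding left_control_def using pt
  proof eventually_elim
    case (elim t)
    show ?case
    proof
      assume t: "t \<in> {0..k}"
      have sc: "((\<lambda>t. \<beta> * t) has_vector_derivative \<beta>) (at t within {0..k})"
        by (auto intro!: derivative_eq_intros)
      have "(\<gamma> has_vector_derivative (\<gamma> (\<beta> * t) ** v (\<beta> * t))) (at (\<beta> * t) within (\<lambda>t. \<beta> * t) ` {0..k})"
        by (rule has_vector_derivative_within_subset[of _ _ _ "{0..\<eta>}"]) (use elim t in_iv in auto)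
      from vector_diff_chain_within[OF sc this]
      have "((\<lambda>t. \<gamma> (\<beta> * t)) has_vector_derivative \<beta> *\<^sub>R (\<gamma> (\<beta> * t) ** v (\<beta> * t))) (at t within {0..k})"
        by (simp add: o_def)
      moreover have "((\<lambda>t. exp (\<alpha> * t / 2)) has_real_derivative exp (\<alpha> * t / 2) * (\<alpha> / 2)) (at t within {0..k})"
        by (auto intro!: derivative_eq_intros)
      ultimately have "(f has_vector_derivative exp (\<alpha> * t / 2) *\<^sub>R (\<beta> *\<^sub>R (\<gamma> (\<beta> * t) ** v (\<beta> * t)))
          + (exp (\<alpha> * t / 2) * (\<alpha> / 2)) *\<^sub>R \<gamma> (\<beta> * t)) (at t within {0..k})"
        unfolding f_def by (intro has_vector_derivative_scaleR)
      moreover have "exp (\<alpha> * t / 2) *\<^sub>R (\<beta> *\<^sub>R (\<gamma> (\<beta> * t) ** v (\<beta> * t)))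
          + (exp (\<alpha> * t / 2) * (\<alpha> / 2)) *\<^sub>R \<gamma> (\<beta> * t) = f t ** u t"
        by (simp add: f_def u_def e0_def matrix_mult.add_right matrix_mult.scaleR_left matrix_mult.scaleR_right
            scaleR_add_right mult.commute add.commute)
      ultimately show "u t \<in> H \<and> (f has_vector_derivative f t ** u t) (at t within {0..k})"
        using u(3)[of t] elim t by auto
    qed
  qed
  ultimately have "horizontal_curve GLp H 0 k f u"
    unfolding horizontal_curve_def using k lip by blast
  moreover have "nonspacelike 0 k u"
    unfolding nonspacelike_def using pt
  proof eventually_elim
    case (elim t)
    then show ?case using u(1)[of t] power_mono[OF \<alpha>, of 2] \<beta>(1) by auto
  qed
  moreover have "future_directed 0 k u"
    unfolding future_directed_def using pt
  proof eventually_elim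
    case (elim t)
    then show ?case using u(2)[of t] \<open>\<alpha> > 0\<close> by auto
  qed
  ultimately show "fd_nonspacelike_curve 0 k f u" unfolding fd_nonspacelike_curve_def by blast
qed

lemma longest_arcI:
  assumes "fd_nonspacelike_curve a b f u"
    and "\<And>a' b' f' u'. fd_nonspacelike_curve a' b' f' u' \<Longrightarrow> f' a' = f a \<Longrightarrow> f' b' = f b \<Longrightarrow>
      lorentz_length a' b' u' \<le> lorentz_length a b u"
  shows "longest_arc a b f u"
  unfolding longest_arc_def lorentz_dist_def
proof (intro conjI antisym)
  show "ereal (lorentz_length a b u) \<le> Sup {ereal (lorentz_length a' b' u') |a' b' f' u'.
      fd_nonspacelike_curve a' b' f' u' \<and> f' a' = f a \<and> f' b' = f b}"
    by (rule Sup_upper) (use assms(1) in blast)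
  show "Sup {ereal (lorentz_length a' b' u') |a' b' f' u'.
      fd_nonspacelike_curve a' b' f' u' \<and> f' a' = f a \<and> f' b' = f b} \<le> ereal (lorentz_length a b u)"
    by (rule Sup_least) (use assms(2) in auto)
qed fact

lemma competitor_length_le:
  assumes dec: "rho_decomposition g \<xi> g1 \<eta>" and "fd_nonspacelike_curve a b f u" "f a = mat 1" "f b = g" "c \<ge> 0"
  shows "lorentz_length a b u \<le> \<xi> * cosh c - \<eta> * sinh c"
proof (rule fd_nonspacelike_curve_bounds[OF assms(2,3)])
  fix \<zeta> h1
  assume h: "f b = exp (\<zeta> / 2) *\<^sub>R h1" "h1 \<in> SL2"
    and len: "\<And>c. c \<ge> 0 \<Longrightarrow> rho (mat 1) h1 \<ge> 0 \<Longrightarrow> lorentz_length a b u \<le> \<zeta> * cosh c - rho (mat 1) h1 * sinh c"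
  have d: "g = exp (\<xi> / 2) *\<^sub>R g1" "g1 \<in> SL2" "\<eta> = rho (mat 1) g1" "\<eta> > 0"
    using dec unfolding rho_decomposition_def by auto
  have "exp (\<xi> / 2) *\<^sub>R g1 = exp (\<zeta> / 2) *\<^sub>R h1" using h d assms(4) by simp
  from decomposition_unique[OF this d(2) h(2)] have "\<zeta> = \<xi>" "h1 = g1" by simp_all
  then show ?thesis using len[OF assms(5)] d(3,4) by simp
qed

lemma timelike_case:
  assumes dec: "rho_decomposition g \<xi> g1 \<eta>" and sa: "shortest_arc 0 \<eta> \<gamma> v" "arclength_parametrized 0 \<eta> v"
    and ends: "\<gamma> 0 = mat 1" "\<gamma> \<eta> = g1" and kc: "k > 0" "c > 0" "\<xi> = k * cosh c" "\<eta> = k * sinh c"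
  defines "f \<equiv> \<lambda>t. exp (cosh c * t / 2) *\<^sub>R \<gamma> (sinh c * t)"
  shows "\<exists>u. longest_arc 0 k f u \<and> timelike 0 k u" "f 0 = mat 1" "f k = g"
proof -
  show f0: "f 0 = mat 1" by (simp add: f_def ends)
  show fk: "f k = g"
    using dec ends kc unfolding rho_decomposition_def f_def by (simp add: mult.commute)
  have s: "sinh c > 0" "\<eta> = sinh c * k" "sinh c \<le> cosh c" "(cosh c)\<^sup>2 - (sinh c)\<^sup>2 = 1"
    using kc by (simp_all add: mult.commute sinh_le_cosh_real hyperbolic_pythagoras)
  note arc = scaled_arc[OF sa s(1-3), folded f_def, unfolded s(4)]
  let ?u = "\<lambda>t. cosh c *\<^sub>R e0 + sinh c *\<^sub>R v (sinh c * t)"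
  have "longest_arc 0 k f ?u"
  proof (rule longest_arcI[OF arc(1)])
    fix a' b' f' u' assume "fd_nonspacelike_curve a' b' f' u'" "f' a' = f 0" "f' b' = f k"
    then have "lorentz_length a' b' u' \<le> \<xi> * cosh c - \<eta> * sinh c"
      using competitor_length_le[OF dec, of a' b' f' u' c] f0 fk kc by simp
    also have "\<dots> = k * ((cosh c)\<^sup>2 - (sinh c)\<^sup>2)"
      unfolding kc by (simp add: power2_eq_square algebra_simps)
    finally show "lorentz_length a' b' u' \<le> lorentz_length 0 k ?u"
      unfolding arc(2) s(4) by simp
  qed
  moreover have "timelike 0 k ?u"
    unfolding timelike_def using arc(3) by eventually_elim auto
  ultimately show "\<exists>u. longest_arc 0 k f u \<and> timelike 0 k u" by blast
qed

lemma isotropic_case: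
  assumes dec: "rho_decomposition g \<xi> g1 \<xi>" and sa: "shortest_arc 0 \<xi> \<gamma> v" "arclength_parametrized 0 \<xi> v"
    and ends: "\<gamma> 0 = mat 1" "\<gamma> \<xi> = g1"
  defines "f \<equiv> \<lambda>t. exp (t / 2) *\<^sub>R \<gamma> t"
  shows "\<exists>u. longest_arc 0 \<xi> f u \<and> isotropic 0 \<xi> u" "f 0 = mat 1" "f \<xi> = g"
proof -
  show f0: "f 0 = mat 1" by (simp add: f_def ends)
  show fk: "f \<xi> = g" using dec ends unfolding rho_decomposition_def f_def by simp
  have "\<xi> > 0" using dec unfolding rho_decomposition_def by simp
  have arc: "fd_nonspacelike_curve 0 \<xi> f (\<lambda>t. e0 + v t)" "lorentz_length 0 \<xi> (\<lambda>t. e0 + v t) = 0"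
    "AE t in lebesgue. t \<in> {0..\<xi>} \<longrightarrow> pseudo_prod (e0 + v t) (e0 + v t) = 0 \<and> e0 + v t \<noteq> 0"
    using scaled_arc[OF sa, of 1 \<xi> 1] by (simp_all add: f_def)
  have "longest_arc 0 \<xi> f (\<lambda>t. e0 + v t)"
  proof (rule longest_arcI[OF arc(1)])
    fix a' b' f' u' assume *: "fd_nonspacelike_curve a' b' f' u'" "f' a' = f 0" "f' b' = f \<xi>"
    have "lorentz_length a' b' u' \<le> 0 + \<epsilon>" if "\<epsilon> > 0" for \<epsilon>
    proof -
      \<comment> \<open>The bound is \<open>\<xi> exp (- c)\<close>, which this \<open>c\<close> makes at most \<open>\<epsilon>\<close>.\<close>
      define c where "c = max 0 (ln (\<xi> / \<epsilon>))"
      have "lorentz_length a' b' u' \<le> \<xi> * cosh c - \<xi> * sinh c"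
        using competitor_length_le[OF dec *(1), of c] * f0 fk by (simp add: c_def)
      also have "\<dots> = \<xi> * exp (- c)" by (simp add: cosh_minus_sinh flip: right_diff_distrib)
      also have "\<dots> \<le> \<xi> * exp (- ln (\<xi> / \<epsilon>))" using \<open>\<xi> > 0\<close> by (intro mult_left_mono) (auto simp: c_def)
      also have "\<dots> = \<epsilon>" using \<open>\<xi> > 0\<close> that by (simp add: exp_minus)
      finally show ?thesis by simp
    qed
    then show "lorentz_length a' b' u' \<le> lorentz_length 0 \<xi> (\<lambda>t. e0 + v t)"
      unfolding arc(2) by (rule field_le_epsilon)
  qed
  moreover have "isotropic 0 \<xi> (\<lambda>t. e0 + v t)"
    unfolding isotropic_def by (rule arc(3))
  ultimately show "\<exists>u. longest_arc 0 \<xi> f u \<and> isotropic 0 \<xi> u" by blast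
qed

lemma hyperbolic_parameters:
  fixes \<xi> \<eta> :: real
  assumes "0 < \<eta>" "\<eta> < \<xi>"
  shows "\<exists>k c. k > 0 \<and> c > 0 \<and> \<xi> = k * cosh c \<and> \<eta> = k * sinh c"
proof -
  define k where "k = sqrt (\<xi>\<^sup>2 - \<eta>\<^sup>2)"
  have "\<eta>\<^sup>2 < \<xi>\<^sup>2" using assms by (intro power_strict_mono) auto
  then have k: "k > 0" "k\<^sup>2 = \<xi>\<^sup>2 - \<eta>\<^sup>2" by (simp_all add: k_def)
  define c where "c = arsinh (\<eta> / k)"
  have s: "sinh c = \<eta> / k" by (simp add: c_def)
  then have "c > 0" using k assms by (metis divide_pos_pos sinh_real_pos_iff)
  have \<eta>: "k * sinh c = \<eta>" using s k(1) by simp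
  have "(k * cosh c)\<^sup>2 = (k * sinh c)\<^sup>2 + k\<^sup>2"
    unfolding power_mult_distrib cosh_square_eq by (simp add: distrib_left)
  then have "(k * cosh c)\<^sup>2 = \<xi>\<^sup>2" unfolding \<eta> k(2) by simp
  then have "\<xi> = k * cosh c"
    by (rule power2_eq_imp_eq[symmetric]) (use k(1) assms in auto)
  then show ?thesis using k(1) \<open>c > 0\<close> \<eta> by blast
qed

theorem theorem5:
  fixes g :: cmat
  assumes "g \<in> GLp"
  shows
    "(\<forall>\<xi> g1 \<eta> \<gamma> v.
        rho_decomposition g \<xi> g1 \<eta> \<and> shortest_arc 0 \<eta> \<gamma> v \<and> arclength_parametrized 0 \<eta> v \<and>
        \<gamma> 0 = mat 1 \<and> \<gamma> \<eta> = g1 \<longrightarrow>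
          (\<xi> > \<eta> \<longrightarrow>
             (\<exists>k c. k > 0 \<and> c > 0 \<and> \<xi> = k * cosh c \<and> \<eta> = k * sinh c) \<and>
             (\<forall>k c. k > 0 \<and> c > 0 \<and> \<xi> = k * cosh c \<and> \<eta> = k * sinh c \<longrightarrow>
                (let f = (\<lambda>t. exp (cosh c * t / 2) *\<^sub>R \<gamma> (sinh c * t)) in
                   (\<exists>u. longest_arc 0 k f u \<and> timelike 0 k u) \<and> f 0 = mat 1 \<and> f k = g))) \<and>
          (\<xi> = \<eta> \<longrightarrow>
             (let f = (\<lambda>t. exp (t / 2) *\<^sub>R \<gamma> t) in
                (\<exists>u. longest_arc 0 \<xi> f u \<and> isotropic 0 \<xi> u) \<and> f 0 = mat 1 \<and> f \<xi> = g))) \<and>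
     (g \<notin> {r *\<^sub>R mat 1 | r. r > 0} \<and> \<not> (\<exists>\<xi> g1 \<eta>. rho_decomposition g \<xi> g1 \<eta>) \<longrightarrow>
        \<not> (\<exists>a b f u. fd_nonspacelike_curve a b f u \<and> f a = mat 1 \<and> f b = g))"
proof (intro conjI allI impI; (elim conjE)?)
  fix \<xi> g1 \<eta> \<gamma> v
  assume dec: "rho_decomposition g \<xi> g1 \<eta>" and sa: "shortest_arc 0 \<eta> \<gamma> v" "arclength_parametrized 0 \<eta> v"
    and ends: "\<gamma> 0 = mat 1" "\<gamma> \<eta> = g1"
  show "\<exists>k c. k > 0 \<and> c > 0 \<and> \<xi> = k * cosh c \<and> \<eta> = k * sinh c" if "\<xi> > \<eta>"
    by (rule hyperbolic_parameters) (use dec that in \<open>simp_all add: rho_decomposition_def\<close>)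
  show "let f = (\<lambda>t. exp (cosh c * t / 2) *\<^sub>R \<gamma> (sinh c * t)) in
      (\<exists>u. longest_arc 0 k f u \<and> timelike 0 k u) \<and> f 0 = mat 1 \<and> f k = g"
    if "k > 0" "c > 0" "\<xi> = k * cosh c" "\<eta> = k * sinh c" for k c
    unfolding Let_def by (intro conjI timelike_case[OF dec sa ends that])
  show "let f = (\<lambda>t. exp (t / 2) *\<^sub>R \<gamma> t) in
      (\<exists>u. longest_arc 0 \<xi> f u \<and> isotropic 0 \<xi> u) \<and> f 0 = mat 1 \<and> f \<xi> = g" if "\<xi> = \<eta>"
    unfolding Let_def that
    by (intro conjI isotropic_case[OF dec[unfolded that] sa ends])
next
  assume no: "g \<notin> {r *\<^sub>R mat 1 | r. r > 0}" "\<not> (\<exists>\<xi> g1 \<eta>. rho_decomposition g \<xi> g1 \<eta>)"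
  show "\<not> (\<exists>a b f u. fd_nonspacelike_curve a b f u \<and> f a = mat 1 \<and> f b = g)"
  proof
    assume "\<exists>a b f u. fd_nonspacelike_curve a b f u \<and> f a = mat 1 \<and> f b = g"
    then obtain a b f u where "fd_nonspacelike_curve a b f u" "f a = mat 1" and fb: "f b = g" by blast
    then show False
    proof (elim fd_nonspacelike_curve_bounds)
      fix \<xi> g1
      assume g1: "f b = exp (\<xi> / 2) *\<^sub>R g1" "g1 \<in> SL2" "rho (mat 1) g1 \<le> \<xi>"
        and pos: "g1 \<noteq> mat 1 \<Longrightarrow> rho (mat 1) g1 > 0"
      show False
      proof (cases "g1 = mat 1")
        case True
        then have "g = exp (\<xi> / 2) *\<^sub>R mat 1" using g1(1) fb by metis
        then have "g \<in> {r *\<^sub>R mat 1 | r. r > 0}"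
          by (intro CollectI exI[of _ "exp (\<xi> / 2)"]) simp
        then show False using no(1) by simp
      next
        case False
        then have "rho_decomposition g \<xi> g1 (rho (mat 1) g1)"
          unfolding rho_decomposition_def by (intro conjI g1(1)[unfolded fb] g1(2,3) pos refl)
        then show False using no(2) by blast
      qed
    qed
  qed
qed

end
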